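(* Let $(\Omega,\mu,d)$ be a metric measure space satisfying the standing assumptions with $\mu(\Omega)=\infty$, and let $X$ be a rearrangement-invariant space on $\Omega$ such that the isoperimetric Hardy operator $\tilde Q_I$ is bounded on $\bar X$. Then for all $f\in Lip_0(\Omega)$ and all $g\in M(\Phi)(\Omega)$, $$\|fg\|_X\le \|g\|_{M(\Phi)}\,\|\tilde Q_I\|_{\bar X\to\bar X}\,\big\||\nabla f|\big\|_X .$$
   Context: Setting and standing assumptions. $(\Omega,\mu,d)$ is a connected metric space with a Borel measure $\mu$ such that $\mu(K)<\infty$ for every compact $K\subset\Omega$, and here $\mu(\Omega)=\infty$. $Lip_0(\Omega)$ is the set of real-valued Lipschitz functions on $\Omega$ with compact support. For such $f$, $|\nabla f(x)|=\limsup_{d(x,y)\to0}\frac{|f(x)-f(y)|}{d(x,y)}$. For a Borel set $A\subset\Omega$, $\mu^+(A)=\liminf_{h\to0}\frac{\mu(A_h)-\mu(A)}{h}$, where $A_h=\{x\in\Omega:d(x,A)<h\}$. The isoperimetric profile is $I:[0,\infty)\to\mathbb{R}_+$, $I(t)=\inf\{\mu^+(A):\mu(A)=t\}$. It is assumed that $I$ is concave, continuous, increasing, and $I(0)=0$ (with $I>0$ on $(0,\infty)$). Rearrangement-invariant (r.i.) spaces. For measurable $u$ on $\Omega$, $\mu_u(t)=\mu\{|u|>t\}$ and $u_\mu^*(s)=\inf\{t\ge0:\mu_u(t)\le s\}$. An r.i. space $X=X(\Omega)$ is a Banach function space in the sense of Bennett–Sharpley (in particular with the Fatou property) such that $g\in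 X$ and $f_\mu^*=g_\mu^*$ imply $f\in X$ and $\|f\|_X=\|g\|_X$. The measure space is assumed resonant (Bennett–Sharpley): for all measurable a.e. finite $f,g$, $\int_0^{\infty}f_\mu^*g_\mu^*\,ds=\sup\int_\Omega|f\tilde g|\,d\mu$, the supremum over all $\tilde g$ equimeasurable with $g$. Then $X$ is represented by an r.i. space $\bar X$ on $(0,\infty)$ with Lebesgue measure such that $\|f\|_X=\|f_\mu^*\|_{\bar X}$. Isoperimetric Hardy operator. $\tilde Q_If(t)=\frac{I(t)}{t}\int_t^{\infty}f(s)\frac{ds}{I(s)}$ for measurable $f$ on $(0,\infty)$. Marcinkiewicz space. With $\Phi(t)=t/I(t)$, $M(\Phi)(\Omega)$ consists of the measurable $g$ with $\|g\|_{M(\Phi)}=\sup_{t>0}g_\mu^*(t)\Phi(t)<\infty$. *)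

theory Defs
  imports "HOL-Analysis.Analysis"
begin

section \<open>Metric measure spaces and the isoperimetric profile\<close>

text \<open>
  The space \<open>\<Omega>\<close> is a type of class \<open>metric_space\<close>; \<open>\<mu>\<close> is a measure with \<open>sets M = sets borel\<close>.
  Quantities in \<open>[0,\<infinity>]\<close> are rendered in \<open>ennreal\<close>.
\<close>

definition Lip0 :: "('a::metric_space \<Rightarrow> real) set" where
  "Lip0 = {f. (\<exists>L. L-lipschitz_on UNIV f) \<and> compact (closure {x. f x \<noteq> 0})}"

definition grad_mod :: "('a::metric_space \<Rightarrow> real) \<Rightarrow> 'a \<Rightarrow> ennreal" where
  "grad_mod f x = Limsup (at x) (\<lambda>y. ennreal (\<bar>f x - f y\<bar> / dist x y))"

text \<open>
  The distance to a set is taken in \<open>ennreal\<close>, so that \<open>d(x, {}) = \<infinity>\<close>; with the library's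
  \<open>infdist\<close>, which is \<open>0\<close> for the empty set, the neighbourhoods of \<open>{}\<close> would be everything.
\<close>

definition nbhd :: "'a::metric_space set \<Rightarrow> real \<Rightarrow> 'a set" where
  "nbhd A h = {x. (INF a\<in>A. ennreal (dist x a)) < ennreal h}"

text \<open>Only used for sets of finite measure, so the truncated difference is the actual one.\<close>

definition perimeter :: "'a::metric_space measure \<Rightarrow> 'a set \<Rightarrow> ennreal" where
  "perimeter M A =
     Liminf (at_right 0) (\<lambda>h. (emeasure M (nbhd A h) - emeasure M A) / ennreal h)"

definition iso_inf :: "'a::metric_space measure \<Rightarrow> real \<Rightarrow> ennreal" where
  "iso_inf M t = (INF A\<in>{A \<in> sets M. emeasure M A = ennreal t}. perimeter M A)"

text \<open>
  The real-valued profile. That the infimum is finite (in particular that the set of competitors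
  is nonempty) for every \<open>t \<ge> 0\<close> is part of \<open>isoperimetric_space\<close> below.
\<close>

definition iso_profile :: "'a::metric_space measure \<Rightarrow> real \<Rightarrow> real" where
  "iso_profile M t = enn2real (iso_inf M t)"

definition isoperimetric_space :: "'a::metric_space measure \<Rightarrow> bool" where
  "isoperimetric_space M \<longleftrightarrow>
     sets M = sets borel \<and>
     connected (UNIV :: 'a set) \<and>
     (\<forall>K. compact K \<longrightarrow> emeasure M K < \<infinity>) \<and>
     emeasure M UNIV = \<infinity> \<and>
     (\<forall>t\<ge>0. iso_inf M t < \<infinity>) \<and>
     concave_on {0..} (iso_profile M) \<and>
     continuous_on {0..} (iso_profile M) \<and>
     mono_on {0..} (iso_profile M) \<and>
     iso_profile M 0 = 0 \<and>
     (\<forall>t>0. iso_profile M t > 0)"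


section \<open>Rearrangements\<close>

definition distribution :: "'b measure \<Rightarrow> ('b \<Rightarrow> ennreal) \<Rightarrow> ennreal \<Rightarrow> ennreal" where
  "distribution M u t = emeasure M {x \<in> space M. t < u x}"

text \<open>
  The level \<open>t = \<infinity>\<close> always satisfies the condition, which encodes the convention
  that the infimum over an empty set of finite levels is \<open>\<infinity>\<close>.
\<close>

definition rearr :: "'b measure \<Rightarrow> ('b \<Rightarrow> ennreal) \<Rightarrow> real \<Rightarrow> ennreal" where
  "rearr M u s = Inf {t. distribution M u t \<le> ennreal s}"

definition absf :: "('b \<Rightarrow> real) \<Rightarrow> 'b \<Rightarrow> ennreal" where
  "absf u x = ennreal \<bar>u x\<bar>"

definition equimeasurable :: "'b measure \<Rightarrow> ('b \<Rightarrow> real) \<Rightarrow> ('b \<Rightarrow> real) \<Rightarrow> bool" where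
  "equimeasurable M u v \<longleftrightarrow>
     (\<forall>t\<ge>0. distribution M (absf u) (ennreal t) = distribution M (absf v) (ennreal t))"

definition resonant :: "'b measure \<Rightarrow> bool" where
  "resonant M \<longleftrightarrow>
     (\<forall>f \<in> borel_measurable M. \<forall>g \<in> borel_measurable M.
        (\<integral>\<^sup>+s\<in>{0<..}. rearr M (absf f) s * rearr M (absf g) s \<partial>lborel) =
        (SUP g'\<in>{g' \<in> borel_measurable M. equimeasurable M g' g}.
            \<integral>\<^sup>+x. absf (\<lambda>x. f x * g' x) x \<partial>M))"


section \<open>Rearrangement-invariant spaces\<close>

text \<open>
  A Banach function space is given by its function norm \<open>\<rho>\<close> on nonnegative measurable functions
  (Bennett--Sharpley, axioms (P1)--(P5)): a measurable \<open>u\<close> belongs to the space iff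
  \<open>\<rho> \<bar>u\<bar> < \<infinity>\<close>, and then its norm is \<open>\<rho> \<bar>u\<bar>\<close>.
  The values of \<open>\<rho>\<close> on nonmeasurable functions are irrelevant.
\<close>

definition banach_function_norm :: "'b measure \<Rightarrow> (('b \<Rightarrow> ennreal) \<Rightarrow> ennreal) \<Rightarrow> bool" where
  "banach_function_norm M \<rho> \<longleftrightarrow>
     (\<forall>f \<in> borel_measurable M. \<rho> f = 0 \<longleftrightarrow> (AE x in M. f x = 0)) \<and>
     (\<forall>f \<in> borel_measurable M. \<forall>c::real. c \<ge> 0 \<longrightarrow>
        \<rho> (\<lambda>x. ennreal c * f x) = ennreal c * \<rho> f) \<and>
     (\<forall>f \<in> borel_measurable M. \<forall>g \<in> borel_measurable M.
        \<rho> (\<lambda>x. f x + g x) \<le> \<rho> f + \<rho> g) \<and>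
     (\<forall>f \<in> borel_measurable M. \<forall>g \<in> borel_measurable M.
        (AE x in M. g x \<le> f x) \<longrightarrow> \<rho> g \<le> \<rho> f) \<and>
     (\<forall>F f. (\<forall>n::nat. F n \<in> borel_measurable M) \<longrightarrow> f \<in> borel_measurable M \<longrightarrow>
        (AE x in M. incseq (\<lambda>n. F n x) \<and> (\<lambda>n. F n x) \<longlonglongrightarrow> f x) \<longrightarrow>
        incseq (\<lambda>n. \<rho> (F n)) \<and> (\<lambda>n. \<rho> (F n)) \<longlonglongrightarrow> \<rho> f) \<and>
     (\<forall>E \<in> sets M. emeasure M E < \<infinity> \<longrightarrow> \<rho> (indicator E) < \<infinity>) \<and>
     (\<forall>E \<in> sets M. emeasure M E < \<infinity> \<longrightarrow>
        (\<exists>C::real. C > 0 \<and>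
           (\<forall>f \<in> borel_measurable M. (\<integral>\<^sup>+x\<in>E. f x \<partial>M) \<le> ennreal C * \<rho> f)))"

definition ri_norm :: "'b measure \<Rightarrow> (('b \<Rightarrow> ennreal) \<Rightarrow> ennreal) \<Rightarrow> bool" where
  "ri_norm M \<rho> \<longleftrightarrow>
     banach_function_norm M \<rho> \<and>
     (\<forall>f \<in> borel_measurable M. \<forall>g \<in> borel_measurable M.
        \<rho> g < \<infinity> \<longrightarrow> (\<forall>s\<ge>0. rearr M f s = rearr M g s) \<longrightarrow> \<rho> f = \<rho> g)"

abbreviation lebesgue_pos :: "real measure" where
  "lebesgue_pos \<equiv> restrict_space lborel {0<..}"

text \<open>
  \<open>\<sigma>\<close> is (the norm of) an r.i. space on \<open>(0,\<infinity>)\<close> representing \<open>\<rho>\<close>: \<open>\<rho> f = \<sigma> (f\<^sup>*)\<close>.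
\<close>

definition represents ::
  "'b measure \<Rightarrow> ((real \<Rightarrow> ennreal) \<Rightarrow> ennreal) \<Rightarrow> (('b \<Rightarrow> ennreal) \<Rightarrow> ennreal) \<Rightarrow> bool" where
  "represents M \<sigma> \<rho> \<longleftrightarrow>
     ri_norm lebesgue_pos \<sigma> \<and>
     (\<forall>f \<in> borel_measurable M. (AE x in M. f x < \<infinity>) \<longrightarrow> \<rho> f = \<sigma> (rearr M f))"

definition fspace :: "'b measure \<Rightarrow> (('b \<Rightarrow> ennreal) \<Rightarrow> ennreal) \<Rightarrow> ('b \<Rightarrow> real) set" where
  "fspace M \<rho> = {u \<in> borel_measurable M. \<rho> (absf u) < \<infinity>}"


section \<open>The isoperimetric Hardy operator\<close>

definition iso_hardy :: "(real \<Rightarrow> real) \<Rightarrow> (real \<Rightarrow> real) \<Rightarrow> real \<Rightarrow> real" where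
  "iso_hardy I f t = I t / t * (LINT s:{t<..}|lborel. f s / I s)"

text \<open>
  Boundedness includes that the integral defining the operator converges (absolutely) for every
  function in the space; otherwise the Bochner integral would silently be \<open>0\<close>.
\<close>

definition iso_hardy_bounded ::
  "(real \<Rightarrow> real) \<Rightarrow> ((real \<Rightarrow> ennreal) \<Rightarrow> ennreal) \<Rightarrow> bool" where
  "iso_hardy_bounded I \<sigma> \<longleftrightarrow>
     (\<forall>f \<in> fspace lebesgue_pos \<sigma>. \<forall>t>0. set_integrable lborel {t<..} (\<lambda>s. f s / I s)) \<and>
     (\<forall>f \<in> fspace lebesgue_pos \<sigma>. iso_hardy I f \<in> fspace lebesgue_pos \<sigma>) \<and>
     (\<exists>C::real. C \<ge> 0 \<and> (\<forall>f \<in> fspace lebesgue_pos \<sigma>.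
         \<sigma> (absf (iso_hardy I f)) \<le> ennreal C * \<sigma> (absf f)))"

definition op_norm ::
  "((real \<Rightarrow> ennreal) \<Rightarrow> ennreal) \<Rightarrow> ((real \<Rightarrow> real) \<Rightarrow> (real \<Rightarrow> real)) \<Rightarrow> ennreal" where
  "op_norm \<sigma> T =
     (SUP f\<in>{f \<in> fspace lebesgue_pos \<sigma>. \<sigma> (absf f) \<le> 1}. \<sigma> (absf (T f)))"


section \<open>The Marcinkiewicz space\<close>

definition marc_norm :: "'b measure \<Rightarrow> (real \<Rightarrow> real) \<Rightarrow> ('b \<Rightarrow> real) \<Rightarrow> ennreal" where
  "marc_norm M \<Phi> g = (SUP t\<in>{0<..}. rearr M (absf g) t * ennreal (\<Phi> t))"

definition marc_space :: "'b measure \<Rightarrow> (real \<Rightarrow> real) \<Rightarrow> ('b \<Rightarrow> real) set" where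
  "marc_space M \<Phi> = {g \<in> borel_measurable M. marc_norm M \<Phi> g < \<infinity>}"

end

(* With w = f\<^sup>*, the coarea inequality bounds I(s) (w(s) - w(s')) by the integral of |\<nabla>f| over
   the slab {w(s') < |f| < w(s)}, whose measure is at most s' - s; hence the discretizations of
   - I w' are majorized, in the sense of Hardy, Littlewood and Polya, by |\<nabla>f|\<^sup>*. Since
   w(t) is the integral of (- I w') / I over (t, \<infinity>), w(t) I(t) / t is the isoperimetric Hardy
   operator applied to - I w', so its norm is at most the operator norm times the norm of |\<nabla>f|.
   Finally (f g)\<^sup>* is majorized by f\<^sup>* g\<^sup>* (resonance), which is at most
   the Marcinkiewicz norm of g times w(t) I(t) / t. *)

theory Submission
  imports Defs "HOL-Combinatorics.Permutations"
begin

text \<open>The norm \<open>\<sigma>\<close> is known only through its axioms, which give invariance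
  under equal rearrangements but not monotonicity under majorization. That monotonicity has to be
  built up: on step functions over a uniform grid the norm is a convex, symmetric, monotone function
  of the heights, so finite majorization applies, and the Fatou axiom carries the result to
  decreasing functions. The axiom accepts only increasing sequences, while lower step functions on
  finer and finer meshes need not increase; this forces the shifted approximants and the factors
  tending to 1 in the limit passages. Discretization also costs exactness in the Hardy operator: the
  coarea inequality yields the profile at the left end of a cell, while the integrand contains it up
  to the right end. Concavity with \<open>I 0 = 0\<close> makes \<open>I t / t\<close> decreasing,
  so the two values have a quotient of at least \<open>k / (k + 1)\<close>, which tends to 1 for
  fixed \<open>t\<close> as the mesh shrinks. The majorization principle is proved for a bounded
  majorant, so bounded \<open>g\<close> precedes general \<open>g\<close>.\<close>

subsection \<open>Finite majorization\<close>

text \<open>Only \<open>a\<close> is sorted, and the full sums need not agree. If \<open>a\<close>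
  lies below \<open>b\<close>, monotonicity of \<open>\<phi>\<close> suffices. Otherwise mass moves
  from a place where \<open>b\<close> exceeds \<open>a\<close> to a later one where it falls short;
  this averages \<open>b\<close> with a transposed copy of itself, so by convexity and symmetry
  \<open>\<phi>\<close> does not grow.\<close>

lemma majorization_le:
  fixes a b :: "nat \<Rightarrow> real" and \<phi> :: "(nat \<Rightarrow> real) \<Rightarrow> real"
  assumes mono: "\<And>a b. (\<forall>i<N. 0 \<le> a i \<and> a i \<le> b i) \<Longrightarrow> \<phi> a \<le> \<phi> b"
    and conv: "\<And>a b t. \<lbrakk>\<forall>i<N. 0 \<le> a i \<and> 0 \<le> b i; 0 \<le> t; t \<le> 1\<rbrakk>
        \<Longrightarrow> \<phi> (\<lambda>i. (1 - t) * a i + t * b i) \<le> (1 - t) * \<phi> a + t * \<phi> b"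
    and symm: "\<And>a i j. \<lbrakk>\<forall>i<N. 0 \<le> a i; i < N; j < N\<rbrakk> \<Longrightarrow> \<phi> (a \<circ> Transposition.transpose i j) = \<phi> a"
    and a: "\<forall>i<N. 0 \<le> a i" "\<And>i j. i \<le> j \<Longrightarrow> j < N \<Longrightarrow> a j \<le> a i"
    and b: "\<forall>i<N. 0 \<le> b i"
    and sums: "\<And>n. n \<le> N \<Longrightarrow> sum a {..<n} \<le> sum b {..<n}"
  shows "\<phi> a \<le> \<phi> b"
  using b sums
proof (induction "card {i. i < N \<and> a i \<noteq> b i}" arbitrary: b rule: less_induct)
  case less
  show ?case
  proof (cases "\<forall>i<N. a i \<le> b i")
    case True
    then show ?thesis using a mono by blast
  next
    case False
    define k where "k = (LEAST i. i < N \<and> b i < a i)"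
    have k: "k < N" "b k < a k"
      using LeastI_ex[of "\<lambda>i. i < N \<and> b i < a i"] False unfolding k_def by (auto simp: not_le)
    have kmin: "a i \<le> b i" if "i < k" for i
      using not_less_Least[OF that[unfolded k_def]] that k(1) by (auto simp: not_less)
    \<comment> \<open>Otherwise the sums over \<open>{..<k}\<close> would agree, and the
      \<open>k\<close>-th terms would violate the hypothesis on sums at
      \<open>Suc k\<close>.\<close>
    have "\<exists>j<k. a j < b j"
    proof (rule ccontr)
      assume "\<not> ?thesis"
      then have "\<forall>j<k. a j = b j" using kmin by (meson antisym not_less)
      then have "sum a {..<k} = sum b {..<k}" by (intro sum.cong) auto
      then show False using less.prems(2)[of "Suc k"] k by simp
    qed
    then have "{j. j < k \<and> a j < b j} \<noteq> {}" by auto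
    \<comment> \<open>Taking the last such index makes \<open>a\<close> and \<open>b\<close> agree
      strictly between \<open>j\<close> and \<open>k\<close>, so the surplus gained at
      \<open>j\<close> survives up to \<open>k\<close>.\<close>
    define j where "j = Max {j. j < k \<and> a j < b j}"
    have j: "j < k" "a j < b j"
      using Max_in[of "{j. j < k \<and> a j < b j}"] \<open>_ \<noteq> {}\<close> unfolding j_def by auto
    have between: "a i = b i" if "j < i" "i < k" for i
    proof (rule ccontr)
      assume "a i \<noteq> b i"
      with kmin[OF that(2)] have "i \<in> {j. j < k \<and> a j < b j}" using that by auto
      then have "i \<le> j" unfolding j_def by (intro Max_ge) auto
      with that show False by simp
    qed
    \<comment> \<open>A T-transform moving mass \<open>d\<close> from \<open>b j\<close> to \<open>b k\<close> makes \<open>b\<close> agree with \<open>a\<close> in one more place.\<close>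
    define d where "d = min (b j - a j) (a k - b k)"
    have d: "0 < d" "d \<le> b j - a j" "d \<le> a k - b k" using j k by (auto simp: d_def)
    have ajk: "a k \<le> a j" using a(2)[of j k] j k by simp
    \<comment> \<open>The weight for which averaging with the transposed copy moves exactly
      \<open>d\<close>; \<open>b j > a j \<ge> a k > b k\<close> makes the divisor positive and
      \<open>t \<le> 1\<close>.\<close>
    define t where "t = d / (b j - b k)"
    have pos: "0 < b j - b k" using d ajk by linarith
    have t: "0 \<le> t" "t \<le> 1" "t * (b j - b k) = d"
      using d ajk pos unfolding t_def by (auto simp: field_simps)
    define b' where "b' = (\<lambda>i. (1 - t) * b i + t * (b \<circ> Transposition.transpose j k) i)"
    have b'j: "b' j = b j - d" using t(3) by (simp add: b'_def algebra_simps)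
    have b'k: "b' k = b k + d" using t(3) by (simp add: b'_def algebra_simps)
    have b'o: "b' i = b i" if "i \<noteq> j" "i \<noteq> k" for i
      using that by (simp add: b'_def algebra_simps)
    have jN: "j < N" using j k by simp
    have b'pos: "\<forall>i<N. 0 \<le> b' i"
    proof (intro allI impI)
      fix i assume "i < N"
      consider "i = j" | "i = k" | "i \<noteq> j" "i \<noteq> k" by blast
      then show "0 \<le> b' i"
        using b'j b'k b'o[of i] d less.prems(1) a(1) \<open>i < N\<close> jN k(1)
        by cases (auto intro!: add_nonneg_nonneg) 
    qed
    have sum_b': "sum b' {..<n} = sum b {..<n} + (if j < n then - d else 0) + (if k < n then d else 0)" for n
    proof (induction n)
      case (Suc n)
      then show ?case using b'j b'k b'o[of n] j by (cases "n = j"; cases "n = k") (auto split: if_splits)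
    qed simp
    have sums': "sum a {..<n} \<le> sum b' {..<n}" if "n \<le> N" for n
    proof (cases "j < n \<and> n \<le> k")
      case False
      then show ?thesis using less.prems(2)[OF that] sum_b'[of n] j by auto
    next
      case True
      \<comment> \<open>At \<open>n = Suc j\<close> the earlier sums are ordered and the
        \<open>j\<close>-th terms differ by at least \<open>d\<close>; the later terms before
        \<open>k\<close> are equal.\<close>
      have "sum a {..<n} \<le> sum b {..<n} - d" using True
      proof (induction n rule: nat_induct)
        case (Suc n)
        show ?case
        proof (cases "n = j")
          case True
          then show ?thesis using less.prems(2)[of j] jN d by simp
        next
          case False
          with Suc show ?thesis using between[of n] by auto
        qed
      qed simp
      then show ?thesis using True sum_b'[of n] by auto
    qed
    have "card {i. i < N \<and> a i \<noteq> b' i} < card {i. i < N \<and> a i \<noteq> b i}"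
    proof (rule psubset_card_mono)
      have "a j = b' j \<or> a k = b' k" unfolding b'j b'k d_def by (auto simp: min_def)
      moreover have "a j \<noteq> b j" "a k \<noteq> b k" using j k by auto
      ultimately show "{i. i < N \<and> a i \<noteq> b' i} \<subset> {i. i < N \<and> a i \<noteq> b i}"
        using b'o jN k(1) by (auto simp: psubset_eq set_eq_iff) metis+
    qed simp
    then have "\<phi> a \<le> \<phi> b'" using less.hyps b'pos sums' by blast
    also have "\<dots> \<le> (1 - t) * \<phi> b + t * \<phi> (b \<circ> Transposition.transpose j k)"
      unfolding b'_def using less.prems(1) jN k(1) t
      by (intro conv) (auto simp: Transposition.transpose_def)
    also have "\<dots> = \<phi> b" using symm[OF less.prems(1) jN k(1)] by (simp add: algebra_simps)
    finally show ?thesis .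
  qed
qed

subsection \<open>Function norms\<close>

lemma banach_function_normD:
  assumes "banach_function_norm M \<rho>"
  shows bfn_scale: "f \<in> borel_measurable M \<Longrightarrow> 0 \<le> c \<Longrightarrow> \<rho> (\<lambda>x. ennreal c * f x) = ennreal c * \<rho> f"
    and bfn_triangle: "f \<in> borel_measurable M \<Longrightarrow> g \<in> borel_measurable M \<Longrightarrow> \<rho> (\<lambda>x. f x + g x) \<le> \<rho> f + \<rho> g"
    and bfn_mono_AE: "f \<in> borel_measurable M \<Longrightarrow> g \<in> borel_measurable M \<Longrightarrow> AE x in M. g x \<le> f x \<Longrightarrow> \<rho> g \<le> \<rho> f"
    and bfn_indicator_finite: "E \<in> sets M \<Longrightarrow> emeasure M E < \<infinity> \<Longrightarrow> \<rho> (indicator E) < \<infinity>"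
  using assms unfolding banach_function_norm_def by blast+

lemma bfn_fatou:
  assumes "banach_function_norm M \<rho>"
    and "\<And>n::nat. F n \<in> borel_measurable M" "f \<in> borel_measurable M"
    and "AE x in M. incseq (\<lambda>n. F n x) \<and> (\<lambda>n. F n x) \<longlonglongrightarrow> f x"
  shows "(\<lambda>n. \<rho> (F n)) \<longlonglongrightarrow> \<rho> f"
  using assms unfolding banach_function_norm_def by blast

text \<open>The Fatou axiom in the form used for all limit passages below. The bound is asked only
  eventually because some estimates hold only for fine enough meshes.\<close>

lemma bfn_le_of_increasing:
  assumes "banach_function_norm M \<rho>"
    and "\<And>n::nat. F n \<in> borel_measurable M" "f \<in> borel_measurable M"
    and "AE x in M. incseq (\<lambda>n. F n x) \<and> (\<lambda>n. F n x) \<longlonglongrightarrow> f x"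
    and "eventually (\<lambda>n. \<rho> (F n) \<le> C) sequentially"
  shows "\<rho> f \<le> C"
  using tendsto_upperbound[OF bfn_fatou[OF assms(1-4)] assms(5)] by simp

lemma AE_lebesgue_pos: "(AE x in lebesgue_pos. P x) \<longleftrightarrow> (AE x in lborel. 0 < x \<longrightarrow> P x)"
  by (subst AE_restrict_space_iff) auto

lemma bfn_mono_pos:
  assumes "banach_function_norm lebesgue_pos \<sigma>"
    and "f \<in> borel_measurable lebesgue_pos" "g \<in> borel_measurable lebesgue_pos"
    and "\<And>x. 0 < x \<Longrightarrow> g x \<le> f x"
  shows "\<sigma> g \<le> \<sigma> f"
  by (rule bfn_mono_AE[OF assms(1-3)]) (use assms(4) in \<open>simp add: AE_lebesgue_pos\<close>)

lemma measurable_lebesgue_posI: "f \<in> borel_measurable borel \<Longrightarrow> f \<in> borel_measurable lebesgue_pos"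
  by (intro measurable_restrict_space1) simp

subsection \<open>Step functions on a uniform grid\<close>

text \<open>Open on the left and closed on the right, so that the cells tile \<open>{0<..}\<close>
  and the first \<open>i\<close> of them fill the interval \<open>{0<..real i * d}\<close> over
  which the integrals are taken.\<close>

definition cell :: "real \<Rightarrow> nat \<Rightarrow> real set" where
  "cell d k = {real k * d <.. real (Suc k) * d}"

definition step :: "real \<Rightarrow> nat \<Rightarrow> (nat \<Rightarrow> real) \<Rightarrow> real \<Rightarrow> real" where
  "step d N a x = (\<Sum>k<N. a k * indicator (cell d k) x)"

lemma cell_cover:
  assumes "0 < d" "0 < x" shows "\<exists>k. x \<in> cell d k"
proof
  \<comment> \<open>The ceiling rather than the floor, since a cell contains its right end.\<close>
  let ?k = "nat (\<lceil>x / d\<rceil> - 1)"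
  have "\<lceil>x / d\<rceil> \<ge> 1" using assms by (simp add: field_simps)
  then have k: "real ?k = real_of_int \<lceil>x / d\<rceil> - 1" by simp
  have "x / d \<le> real_of_int \<lceil>x / d\<rceil>" "real_of_int \<lceil>x / d\<rceil> - 1 < x / d" by linarith+
  then have "x \<le> real_of_int \<lceil>x / d\<rceil> * d" "(real_of_int \<lceil>x / d\<rceil> - 1) * d < x"
    using assms by (simp_all only: pos_divide_le_eq pos_less_divide_eq)
  then show "x \<in> cell d ?k" unfolding cell_def using k by simp
qed

lemma cell_unique:
  assumes "0 < d" "x \<in> cell d j" "x \<in> cell d k" shows "j = k"
proof (rule ccontr)
  have *: False if "x \<in> cell d j" "x \<in> cell d k" "j < k" for j k
  proof -
    have "real (Suc j) * d \<le> real k * d" using that assms(1) by (intro mult_right_mono) auto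
    with that show False by (auto simp: cell_def)
  qed
  assume "j \<noteq> k"
  then show False using * assms by (metis nat_neq_iff)
qed

lemma step_cell:
  assumes "0 < d" "x \<in> cell d j"
  shows "step d N a x = (if j < N then a j else 0)"
proof -
  have "a k * indicator (cell d k) x = (if k = j then a j else 0)" for k
    using cell_unique[OF assms, of k] assms(2) by (cases "k = j") (auto simp: indicator_def)
  then have "step d N a x = (\<Sum>k<N. if k = j then a j else 0)"
    unfolding step_def by simp
  then show ?thesis by simp
qed

lemma cell_pos: "0 < d \<Longrightarrow> x \<in> cell d j \<Longrightarrow> 0 < x"
proof -
  assume "0 < d" "x \<in> cell d j"
  then have "0 \<le> real j * d" "real j * d < x" by (auto simp: cell_def)
  then show ?thesis by (rule le_less_trans)
qed

lemma step_nonpos: "0 < d \<Longrightarrow> x \<le> 0 \<Longrightarrow> step d N a x = 0"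
  unfolding step_def using cell_pos[of d x] by (intro sum.neutral) (auto simp: indicator_def)

lemma sets_cell [measurable]: "cell d k \<in> sets borel"
  by (simp add: cell_def)

lemma emeasure_cell: "0 < d \<Longrightarrow> emeasure lborel (cell d k) = ennreal d"
  by (simp add: cell_def algebra_simps)

lemma borel_measurable_step [measurable]: "step d N a \<in> borel_measurable borel"
  unfolding step_def by measurable

lemma step_nonneg: "\<forall>k<N. 0 \<le> a k \<Longrightarrow> 0 \<le> step d N a x"
  unfolding step_def by (intro sum_nonneg mult_nonneg_nonneg) auto

lemma ennreal_step:
  assumes "\<forall>k<N. 0 \<le> a k"
  shows "ennreal (step d N a x) = (\<Sum>k<N. ennreal (a k) * indicator (cell d k) x)"
proof -
  have "(\<Sum>k<N. ennreal (a k) * indicator (cell d k) x) = (\<Sum>k<N. ennreal (a k * indicator (cell d k) x))"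
    by (intro sum.cong) (auto simp: indicator_def)
  also have "\<dots> = ennreal (step d N a x)"
    unfolding step_def using assms by (intro sum_ennreal) auto
  finally show ?thesis by simp
qed

lemma nn_integral_step:
  assumes "0 < d" "\<forall>k<N. 0 \<le> a k"
  shows "(\<integral>\<^sup>+x. ennreal (step d N a x) \<partial>lborel) = ennreal (d * sum a {..<N})"
proof -
  have "(\<integral>\<^sup>+x. ennreal (step d N a x) \<partial>lborel) = (\<Sum>k<N. ennreal (a k) * ennreal d)"
    unfolding ennreal_step[OF assms(2)]
    by (subst nn_integral_sum) (auto simp: nn_integral_cmult_indicator emeasure_cell[OF assms(1)])
  also have "\<dots> = ennreal (\<Sum>k<N. a k * d)"
    using assms by (subst sum_ennreal[symmetric]) (auto simp: ennreal_mult)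
  finally show ?thesis by (simp add: sum_distrib_left mult.commute)
qed

text \<open>All cells have the same length, so only the number of heights above the level counts;
  the permutation invariance of the norm rests on this.\<close>

lemma distribution_step:
  assumes "0 < d" "\<forall>k<N. 0 \<le> a k"
  shows "distribution lebesgue_pos (\<lambda>x. ennreal (step d N a x)) t
    = of_nat (card {k. k < N \<and> t < ennreal (a k)}) * ennreal d"
proof -
  let ?K = "{k. k < N \<and> t < ennreal (a k)}"
  have eq: "{x \<in> space lebesgue_pos. t < ennreal (step d N a x)} = (\<Union>k\<in>?K. cell d k)"
  proof (intro set_eqI iffI)
    fix x assume x: "x \<in> {x \<in> space lebesgue_pos. t < ennreal (step d N a x)}"
    then obtain k where k: "x \<in> cell d k" using cell_cover[OF assms(1)] by (auto simp: space_restrict_space)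
    then show "x \<in> (\<Union>k\<in>?K. cell d k)" using x step_cell[OF assms(1) k, of N a]
      by (auto split: if_splits)
  next
    fix x assume "x \<in> (\<Union>k\<in>?K. cell d k)"
    then obtain k where k: "x \<in> cell d k" "k \<in> ?K" by auto
    then show "x \<in> {x \<in> space lebesgue_pos. t < ennreal (step d N a x)}"
      using step_cell[OF assms(1) k(1), of N a] cell_pos[OF assms(1) k(1)]
      by (auto simp: space_restrict_space)
  qed
  have "emeasure lebesgue_pos (\<Union>k\<in>?K. cell d k) = emeasure lborel (\<Union>k\<in>?K. cell d k)"
    using cell_pos[OF assms(1)] by (intro emeasure_restrict_space) auto
  also have "\<dots> = (\<Sum>k\<in>?K. emeasure lborel (cell d k))"
    using cell_unique[OF assms(1)]
    by (intro sum_emeasure[symmetric]) (auto simp: disjoint_family_on_def)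
  finally show ?thesis unfolding distribution_def eq using assms(1) by (simp add: emeasure_cell)
qed

lemma step_norm_finite:
  assumes "banach_function_norm lebesgue_pos \<sigma>" "0 < d" "\<forall>k<N. 0 \<le> a k"
  shows "\<sigma> (\<lambda>x. ennreal (step d N a x)) < \<infinity>"
proof -
  define c where "c = sum a {..<N}"
  have c: "0 \<le> c" "\<And>k. k < N \<Longrightarrow> a k \<le> c" unfolding c_def using assms(3)
    by (auto intro!: sum_nonneg member_le_sum)
  let ?E = "{0<..real N * d}"
  have E: "?E \<in> sets lebesgue_pos" by (auto simp: sets_restrict_space image_iff intro!: bexI[of _ ?E])
  have "\<sigma> (\<lambda>x. ennreal (step d N a x)) \<le> \<sigma> (\<lambda>x. ennreal c * indicator ?E x)"
  proof (rule bfn_mono_pos[OF assms(1)])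
    fix x :: real assume "0 < x"
    then obtain k where k: "x \<in> cell d k" using cell_cover[OF assms(2)] by auto
    have "k < N \<Longrightarrow> x \<in> ?E"
    proof -
      assume "k < N"
      then have "real (Suc k) * d \<le> real N * d" using assms(2) by (intro mult_right_mono) auto
      then show ?thesis using k \<open>0 < x\<close> by (auto simp: cell_def)
    qed
    then show "ennreal (step d N a x) \<le> ennreal c * indicator ?E x"
      unfolding step_cell[OF assms(2) k] using c by (auto intro: ennreal_leI)
  qed (auto intro!: measurable_lebesgue_posI)
  also have "\<dots> = ennreal c * \<sigma> (indicator ?E)"
    using E c by (intro bfn_scale[OF assms(1)]) auto
  also have "\<dots> < \<infinity>"
  proof -
    have "emeasure lebesgue_pos ?E < \<infinity>"
      using assms(2) by (subst emeasure_restrict_space) (auto simp: emeasure_lborel_Ioc)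
    then show ?thesis using bfn_indicator_finite[OF assms(1) E] by (simp add: ennreal_mult_less_top)
  qed
  finally show ?thesis .
qed

text \<open>A permutation maps the indices of heights above a level bijectively, so both functions
  have the same rearrangement. The invariance axiom asks for a finite norm, which
  \<open>step_norm_finite\<close> supplies.\<close>

lemma step_norm_permute:
  assumes "ri_norm lebesgue_pos \<sigma>" "0 < d" "\<forall>k<N. 0 \<le> a k" "\<pi> permutes {..<N}"
  shows "\<sigma> (\<lambda>x. ennreal (step d N (a \<circ> \<pi>) x)) = \<sigma> (\<lambda>x. ennreal (step d N a x))"
proof -
  have pos: "\<forall>k<N. 0 \<le> (a \<circ> \<pi>) k" using assms(3) permutes_in_image[OF assms(4)] by simp
  have "card {k. k < N \<and> t < ennreal ((a \<circ> \<pi>) k)} = card {k. k < N \<and> t < ennreal (a k)}" for t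
  proof (rule bij_betw_same_card)
    show "bij_betw \<pi> {k. k < N \<and> t < ennreal ((a \<circ> \<pi>) k)} {k. k < N \<and> t < ennreal (a k)}"
    proof (rule bij_betw_imageI)
      show "inj_on \<pi> {k. k < N \<and> t < ennreal ((a \<circ> \<pi>) k)}"
        using permutes_inj[OF assms(4)] by (rule inj_on_subset) auto
      show "\<pi> ` {k. k < N \<and> t < ennreal ((a \<circ> \<pi>) k)} = {k. k < N \<and> t < ennreal (a k)}"
      proof (intro set_eqI iffI)
        fix k assume k: "k \<in> {k. k < N \<and> t < ennreal (a k)}"
        then have "k = \<pi> (inv \<pi> k)" "inv \<pi> k < N"
          using permutes_inverses[OF assms(4)] permutes_in_image[OF permutes_inv[OF assms(4)], of k]
          by auto
        then show "k \<in> \<pi> ` {k. k < N \<and> t < ennreal ((a \<circ> \<pi>) k)}" using k by auto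
      qed (use permutes_in_image[OF assms(4)] in auto)
    qed
  qed
  then have "rearr lebesgue_pos (\<lambda>x. ennreal (step d N (a \<circ> \<pi>) x)) s
      = rearr lebesgue_pos (\<lambda>x. ennreal (step d N a x)) s" for s
    unfolding rearr_def distribution_step[OF assms(2) pos] distribution_step[OF assms(2,3)] by simp
  moreover have "\<sigma> (\<lambda>x. ennreal (step d N a x)) < \<infinity>"
    using assms by (intro step_norm_finite) (auto simp: ri_norm_def)
  moreover have "(\<lambda>x. ennreal (step d N b x)) \<in> borel_measurable lebesgue_pos" for b
    by (intro measurable_lebesgue_posI) measurable
  ultimately show ?thesis using assms(1) unfolding ri_norm_def by blast
qed

text \<open>As a function of the heights the norm is monotone, convex by homogeneity and the
  triangle inequality, and symmetric, so \<open>majorization_le\<close> applies. Its finiteness on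
  step functions allows a real-valued \<open>\<phi>\<close>.\<close>

lemma step_norm_majorization:
  assumes ri: "ri_norm lebesgue_pos \<sigma>" and d: "0 < d"
    and a: "\<forall>k<N. 0 \<le> a k" "\<And>i j. i \<le> j \<Longrightarrow> j < N \<Longrightarrow> a j \<le> a i"
    and b: "\<forall>k<N. 0 \<le> b k"
    and sums: "\<And>n. n \<le> N \<Longrightarrow> sum a {..<n} \<le> sum b {..<n}"
  shows "\<sigma> (\<lambda>x. ennreal (step d N a x)) \<le> \<sigma> (\<lambda>x. ennreal (step d N b x))"
proof -
  define \<phi> where "\<phi> = (\<lambda>a. enn2real (\<sigma> (\<lambda>x. ennreal (step d N a x))))"
  have bfn: "banach_function_norm lebesgue_pos \<sigma>" using ri by (simp add: ri_norm_def)
  have fin: "\<forall>k<N. 0 \<le> a k \<Longrightarrow> \<sigma> (\<lambda>x. ennreal (step d N a x)) = ennreal (\<phi> a)" for a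
    using step_norm_finite[OF bfn d] unfolding \<phi>_def by simp
  have meas: "(\<lambda>x. ennreal (step d N b x)) \<in> borel_measurable lebesgue_pos" for b
    by (intro measurable_lebesgue_posI) measurable
  have \<phi>_nonneg: "0 \<le> \<phi> a" for a by (simp add: \<phi>_def)
  have "\<phi> a \<le> \<phi> b"
  proof (rule majorization_le[where N = N and \<phi> = \<phi>])
    fix a b :: "nat \<Rightarrow> real" assume ab: "\<forall>i<N. 0 \<le> a i \<and> a i \<le> b i"
    have "\<sigma> (\<lambda>x. ennreal (step d N a x)) \<le> \<sigma> (\<lambda>x. ennreal (step d N b x))"
    proof (rule bfn_mono_pos[OF bfn meas meas])
      fix x show "ennreal (step d N a x) \<le> ennreal (step d N b x)"
        unfolding step_def using ab by (intro ennreal_leI sum_mono mult_right_mono) auto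
    qed
    moreover have "\<forall>i<N. 0 \<le> a i" "\<forall>i<N. 0 \<le> b i" using ab by force+
    ultimately show "\<phi> a \<le> \<phi> b" using fin[of a] fin[of b] \<phi>_nonneg by simp
  next
    fix a b :: "nat \<Rightarrow> real" and t :: real
    assume ab: "\<forall>i<N. 0 \<le> a i \<and> 0 \<le> b i" and t: "0 \<le> t" "t \<le> 1"
    have split: "ennreal (step d N (\<lambda>i. (1 - t) * a i + t * b i) x)
        = ennreal (1 - t) * ennreal (step d N a x) + ennreal t * ennreal (step d N b x)" for x
    proof -
      have "step d N (\<lambda>i. (1 - t) * a i + t * b i) x = (1 - t) * step d N a x + t * step d N b x"
        unfolding step_def sum_distrib_left sum.distrib[symmetric]
        by (intro sum.cong) (auto simp: algebra_simps)
      moreover have "0 \<le> step d N a x" "0 \<le> step d N b x" using ab by (auto intro!: step_nonneg)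
      ultimately show ?thesis using t by (simp add: ennreal_mult)
    qed
    have "ennreal (\<phi> (\<lambda>i. (1 - t) * a i + t * b i)) =
       \<sigma> (\<lambda>x. ennreal (1 - t) * ennreal (step d N a x) + ennreal t * ennreal (step d N b x))"
      using ab t by (subst fin[symmetric]) (auto simp: split)
    also have "\<dots> \<le> \<sigma> (\<lambda>x. ennreal (1 - t) * ennreal (step d N a x)) + \<sigma> (\<lambda>x. ennreal t * ennreal (step d N b x))"
      by (intro bfn_triangle[OF bfn] measurable_lebesgue_posI) measurable
    also have "\<dots> = ennreal (1 - t) * \<sigma> (\<lambda>x. ennreal (step d N a x)) + ennreal t * \<sigma> (\<lambda>x. ennreal (step d N b x))"
      using t by (simp only: bfn_scale[OF bfn meas])
    also have "\<dots> = ennreal ((1 - t) * \<phi> a + t * \<phi> b)"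
      using ab t fin[of a] fin[of b] \<phi>_nonneg by (simp add: ennreal_mult)
    finally show "\<phi> (\<lambda>i. (1 - t) * a i + t * b i) \<le> (1 - t) * \<phi> a + t * \<phi> b"
      using t \<phi>_nonneg by (subst (asm) ennreal_le_iff) (auto intro!: add_nonneg_nonneg mult_nonneg_nonneg)
  next
    fix a :: "nat \<Rightarrow> real" and i j assume "\<forall>i<N. 0 \<le> a i" "i < N" "j < N"
    then show "\<phi> (a \<circ> Transposition.transpose i j) = \<phi> a"
      unfolding \<phi>_def by (simp add: step_norm_permute[OF ri d] permutes_swap_id)
  qed (use a b sums in auto)
  then show ?thesis using fin[OF a(1)] fin[OF b] \<phi>_nonneg by (simp add: ennreal_leI)
qed

subsection \<open>The Hardy--Littlewood--Polya principle\<close>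

text \<open>A monotone function has at most countably many discontinuities. Approaching from the
  right makes the values of a decreasing function increase, as the Fatou axiom requires.\<close>

lemma antimono_AE_right_limit:
  fixes p :: "real \<Rightarrow> real"
  assumes "antimono_on {0<..} p"
  shows "AE x in lborel. 0 < x \<longrightarrow> (\<lambda>n. p (x + 1 / real (Suc n))) \<longlonglongrightarrow> p x"
proof -
  have "mono_on {0<..} (\<lambda>x. - p x)" using assms by (auto simp: monotone_on_def)
  from mono_on_ctble_discont[OF this]
  have "countable {x \<in> {0<..}. \<not> continuous (at x within {0<..}) (\<lambda>x. - p x)}" .
  then have "AE x in lborel. x \<notin> {x \<in> {0<..}. \<not> continuous (at x within {0<..}) (\<lambda>x. - p x)}"
    by (intro AE_not_in countable_imp_null_set_lborel)
  then show ?thesis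
  proof (rule AE_mp, intro AE_I2 impI)
    fix x :: real assume x: "x \<notin> {x \<in> {0<..}. \<not> continuous (at x within {0<..}) (\<lambda>x. - p x)}" "0 < x"
    have lim: "(\<lambda>n. x + 1 / real (Suc n)) \<longlonglongrightarrow> x"
      using tendsto_add[OF tendsto_const[of x] LIMSEQ_inverse_real_of_nat] by (simp add: inverse_eq_divide)
    have cont: "continuous (at x within {0<..}) p"
      using x continuous_minus[of "at x within {0<..}" "\<lambda>x. - p x"] by simp
    have "((\<lambda>y. p y) \<circ> (\<lambda>n. x + 1 / real (Suc n))) \<longlonglongrightarrow> p x"
    proof (rule cont[unfolded continuous_within_sequentially, rule_format], intro conjI allI lim)
      fix n show "x + 1 / real (Suc n) \<in> {0<..}" using x(2) by (simp add: add_pos_pos)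
    qed
    then show "(\<lambda>n. p (x + 1 / real (Suc n))) \<longlonglongrightarrow> p x" by (simp add: o_def)
  qed
qed

lemma lower_sum_le:
  fixes p :: "real \<Rightarrow> real"
  assumes "antimono_on {0<..} p" "\<And>x. 0 < x \<Longrightarrow> 0 \<le> p x" "0 < d"
  shows "ennreal (d * (\<Sum>k<i. p (real (Suc k) * d))) \<le> (\<integral>\<^sup>+x\<in>{0<..real i * d}. ennreal (p x) \<partial>lborel)"
proof -
  have pos: "0 < real (Suc k) * d" for k using assms(3) by simp
  have "ennreal (d * (\<Sum>k<i. p (real (Suc k) * d)))
      = (\<integral>\<^sup>+x. ennreal (step d i (\<lambda>k. p (real (Suc k) * d)) x) \<partial>lborel)"
    using assms(2)[OF pos] by (subst nn_integral_step[OF assms(3)]) auto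
  also have "\<dots> \<le> (\<integral>\<^sup>+x\<in>{0<..real i * d}. ennreal (p x) \<partial>lborel)"
  proof (rule nn_integral_mono)
    fix x :: real
    show "ennreal (step d i (\<lambda>k. p (real (Suc k) * d)) x) \<le> ennreal (p x) * indicator {0<..real i * d} x"
    proof (cases "0 < x")
      case True
      then obtain k where k: "x \<in> cell d k" using cell_cover[OF assms(3)] by auto
      then have x: "real k * d < x" "x \<le> real (Suc k) * d" by (auto simp: cell_def)
      have le: "p (real (Suc k) * d) \<le> p x"
        using monotone_onD[OF assms(1) _ _ x(2)] True pos[of k] by auto
      have "k < i \<Longrightarrow> x \<le> real i * d"
        using order_trans[OF x(2) mult_right_mono[of "real (Suc k)" "real i" d]] assms(3) by simp
      then show ?thesis using step_cell[OF assms(3) k, of i] True le by (auto intro: ennreal_leI)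
    qed (simp add: step_nonpos[OF assms(3)])
  qed
  finally show ?thesis .
qed

text \<open>The upper sum takes \<open>q\<close> at the left ends of the cells. The first left end
  is 0, where nothing is known of \<open>q\<close>, and \<open>B\<close> stands in for it; the other
  left ends are right ends of preceding cells. Hence the error \<open>d * B\<close> against the
  lower sum.\<close>

lemma le_upper_sum:
  fixes q :: "real \<Rightarrow> real"
  assumes "antimono_on {0<..} q" "\<And>x. 0 < x \<Longrightarrow> 0 \<le> q x" "\<And>x. 0 < x \<Longrightarrow> q x \<le> B" "0 < d"
  shows "(\<integral>\<^sup>+x\<in>{0<..real i * d}. ennreal (q x) \<partial>lborel) \<le> ennreal (d * (B + (\<Sum>k<i. q (real (Suc k) * d))))"
proof (cases i)
  case (Suc m)
  define b where "b = (\<lambda>k. if k = 0 then B else q (real k * d))"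
  have B: "0 \<le> B" using assms(2,3)[of 1] by simp
  have pos: "0 \<le> b k" for k using assms(2)[of "real k * d"] assms(4) B by (auto simp: b_def)
  have "(\<integral>\<^sup>+x\<in>{0<..real i * d}. ennreal (q x) \<partial>lborel) \<le> (\<integral>\<^sup>+x. ennreal (step d i b x) \<partial>lborel)"
  proof (rule nn_integral_mono)
    fix x :: real
    show "ennreal (q x) * indicator {0<..real i * d} x \<le> ennreal (step d i b x)"
    proof (cases "x \<in> {0<..real i * d}")
      case True
      then obtain k where k: "x \<in> cell d k" using cell_cover[OF assms(4)] by auto
      then have x: "real k * d < x" by (auto simp: cell_def)
      with True have "real k * d < real i * d" by simp
      then have "k < i" using assms(4) by simp
      moreover have "q x \<le> b k"
        using monotone_onD[OF assms(1), of "real k * d" x] x assms(3)[of x] assms(4) True by (auto simp: b_def)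
      ultimately show ?thesis using step_cell[OF assms(4) k, of i b] True by (auto intro: ennreal_leI)
    qed simp
  qed
  also have "\<dots> = ennreal (d * sum b {..<i})" using pos by (intro nn_integral_step assms) auto
  also have "sum b {..<i} = B + (\<Sum>k<m. q (real (Suc k) * d))"
    unfolding Suc sum.lessThan_Suc_shift by (simp add: b_def)
  also have "ennreal (d * (B + (\<Sum>k<m. q (real (Suc k) * d)))) \<le> ennreal (d * (B + (\<Sum>k<i. q (real (Suc k) * d))))"
    using assms(4) assms(2)[of "real (Suc m) * d"] unfolding Suc by (intro ennreal_leI mult_left_mono) auto
  finally show ?thesis .
qed simp

text \<open>On grids of mesh \<open>d \<longlonglongrightarrow> 0\<close> the lower step function of \<open>(1 - \<epsilon>) p\<close> is majorized
  by that of \<open>q\<close>: up to \<open>t0\<close> termwise, and beyond \<open>t0\<close> because the discretization error \<open>B d\<close> of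
  the integral of \<open>q\<close> is absorbed by \<open>\<epsilon>\<close> times the integral of \<open>p\<close>.\<close>

theorem hardy_littlewood_polya:
  fixes p q :: "real \<Rightarrow> real"
  assumes ri: "ri_norm lebesgue_pos \<sigma>"
    and p: "antimono_on {0<..} p" "\<And>x. 0 < x \<Longrightarrow> 0 \<le> p x"
    and q: "antimono_on {0<..} q" "\<And>x. 0 < x \<Longrightarrow> 0 \<le> q x" "\<And>x. 0 < x \<Longrightarrow> q x \<le> B"
    and [measurable]: "p \<in> borel_measurable borel" "q \<in> borel_measurable borel"
    and maj: "\<And>t. 0 < t \<Longrightarrow>
      (\<integral>\<^sup>+x\<in>{0<..t}. ennreal (p x) \<partial>lborel) \<le> (\<integral>\<^sup>+x\<in>{0<..t}. ennreal (q x) \<partial>lborel)"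
  shows "\<sigma> (\<lambda>x. ennreal (p x)) \<le> \<sigma> (\<lambda>x. ennreal (q x))"
\<comment> \<open>A point \<open>x0\<close> with \<open>p x0 > 0\<close> bounds the integral of
  \<open>p\<close> from below near 0, and only this can absorb the error \<open>d * B\<close>;
  without such a point \<open>p\<close> vanishes on \<open>{0<..}\<close>.\<close>
proof (cases "\<exists>x>0. 0 < p x")
  case False
  show ?thesis
  proof (rule bfn_mono_pos[where \<sigma> = \<sigma>])
    fix x :: real assume "0 < x"
    with False have "p x \<le> 0" by force
    then show "ennreal (p x) \<le> ennreal (q x)" by (simp add: ennreal_neg)
  qed (use ri in \<open>auto simp: ri_norm_def intro!: measurable_lebesgue_posI\<close>)
next
  case True
  then obtain x0 where x0: "0 < x0" "0 < p x0" by auto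
  have bfn: "banach_function_norm lebesgue_pos \<sigma>" using ri by (simp add: ri_norm_def)
  \<comment> \<open>The limit of \<open>q\<close> at 0. Comparing the integrals over
    \<open>{0<..x}\<close> gives \<open>x * p x \<le> x * Q\<close>, so \<open>p\<close> stays below
    \<open>Q\<close> as well.\<close>
  define Q where "Q = (SUP x\<in>{0<..}. q x)"
  have bdd: "bdd_above (q ` {0<..})" using q(3) by (auto intro!: bdd_aboveI2)
  have qQ: "q x \<le> Q" if "0 < x" for x unfolding Q_def using that by (intro cSUP_upper bdd) auto
  have pQ: "p x \<le> Q" if x: "0 < x" for x
  proof -
    have "ennreal (x * p x) \<le> (\<integral>\<^sup>+y\<in>{0<..x}. ennreal (p y) \<partial>lborel)"
      using lower_sum_le[OF p x, of 1] by simp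
    also have "\<dots> \<le> (\<integral>\<^sup>+y\<in>{0<..x}. ennreal (q y) \<partial>lborel)" using maj[OF x] .
    also have "\<dots> \<le> (\<integral>\<^sup>+y. ennreal Q * indicator {0<..x} y \<partial>lborel)"
      using qQ by (intro nn_integral_mono) (auto simp: indicator_def intro: ennreal_leI)
    also have "\<dots> = ennreal (x * Q)"
      using x qQ[of 1] q(2)[of 1] by (simp add: nn_integral_cmult_indicator ennreal_mult mult.commute)
    finally show ?thesis using x qQ[of 1] q(2)[of 1] by (simp add: ennreal_le_iff)
  qed
  have Qpos: "0 < Q" using pQ[OF x0(1)] x0 by simp
  have B: "0 \<le> B" using q(2,3)[of 1] by simp
  have key: "\<sigma> (\<lambda>x. ennreal (1 - \<epsilon>) * ennreal (p x)) \<le> \<sigma> (\<lambda>x. ennreal (q x))" if \<epsilon>: "0 < \<epsilon>" "\<epsilon> < 1" for \<epsilon>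
  proof -
    have "(1 - \<epsilon>) * Q < Q" using Qpos \<epsilon> by (simp add: algebra_simps)
    then obtain t1 where t1: "0 < t1" "(1 - \<epsilon>) * Q < q t1"
      unfolding Q_def using less_cSUP_iff[OF _ bdd] by auto
    \<comment> \<open>Two things hold on \<open>{0<..t0}\<close>: \<open>q\<close> is at least
      \<open>(1 - \<epsilon>) * Q\<close> and hence dominates \<open>(1 - \<epsilon>) * p\<close>,
      and \<open>p\<close> is at least \<open>p x0\<close>.\<close>
    define t0 where "t0 = min t1 x0"
    have t0: "0 < t0" "t0 \<le> x0" "(1 - \<epsilon>) * Q \<le> q t0"
      using t1 x0 monotone_onD[OF q(1), of t0 t1] by (auto simp: t0_def)
    have step_le: "\<sigma> (\<lambda>x. ennreal (step d N (\<lambda>k. (1 - \<epsilon>) * p (real (Suc k) * d)) x)) \<le> \<sigma> (\<lambda>x. ennreal (q x))"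
      if d: "0 < d" and small: "B \<le> \<epsilon> * ((t0 / d - 1) * p x0)" for d N
    proof -
      have pos: "0 < real (Suc k) * d" for k using d by simp
      have "\<sigma> (\<lambda>x. ennreal (step d N (\<lambda>k. (1 - \<epsilon>) * p (real (Suc k) * d)) x))
          \<le> \<sigma> (\<lambda>x. ennreal (step d N (\<lambda>k. q (real (Suc k) * d)) x))"
      proof (rule step_norm_majorization[OF ri d])
        show "\<forall>k<N. 0 \<le> (1 - \<epsilon>) * p (real (Suc k) * d)" "\<forall>k<N. 0 \<le> q (real (Suc k) * d)"
          using p(2)[OF pos] q(2)[OF pos] \<epsilon> by auto
        show "(1 - \<epsilon>) * p (real (Suc j) * d) \<le> (1 - \<epsilon>) * p (real (Suc i) * d)" if "i \<le> j" for i j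
        proof -
          have "real (Suc i) * d \<le> real (Suc j) * d" using that d by (intro mult_right_mono) auto
          then show ?thesis using monotone_onD[OF p(1)] pos \<epsilon> by (intro mult_left_mono) auto
        qed
        fix i
        show "(\<Sum>k<i. (1 - \<epsilon>) * p (real (Suc k) * d)) \<le> (\<Sum>k<i. q (real (Suc k) * d))"
        proof (cases "real i * d \<le> t0")
          case True
          show ?thesis
          proof (rule sum_mono)
            fix k assume "k \<in> {..<i}"
            then have "real (Suc k) * d \<le> real i * d" using d by (intro mult_right_mono) auto
            then have "q t0 \<le> q (real (Suc k) * d)"
              using True monotone_onD[OF q(1), of "real (Suc k) * d" t0] pos[of k] t0(1) by simp
            moreover have "(1 - \<epsilon>) * p (real (Suc k) * d) \<le> (1 - \<epsilon>) * Q"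
              using pQ[OF pos[of k]] \<epsilon> by (intro mult_left_mono) auto
            ultimately show "(1 - \<epsilon>) * p (real (Suc k) * d) \<le> q (real (Suc k) * d)" using t0(3) by linarith
          qed
        next
          case False
          \<comment> \<open>The number of grid nodes in \<open>{0<..t0}\<close>. Each contributes at
            least \<open>p x0\<close> to the sum of \<open>p\<close> over the nodes, so by
            \<open>small\<close> that sum times \<open>\<epsilon>\<close> covers
            \<open>B\<close>.\<close>
          define j where "j = nat \<lfloor>t0 / d\<rfloor>"
          have "0 \<le> t0 / d" using t0 d by simp
          then have j: "real j \<le> t0 / d" "t0 / d - 1 \<le> real j" unfolding j_def by linarith+
          have jd: "real j * d \<le> t0" using j(1) d by (simp add: field_simps)
          with False have "real j * d < real i * d" by simp
          then have ji: "j \<le> i" using d by simp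
          have "(t0 / d - 1) * p x0 \<le> real j * p x0" using j x0 by (intro mult_right_mono) auto
          also have "\<dots> = (\<Sum>k<j. p x0)" by simp
          also have "\<dots> \<le> (\<Sum>k<j. p (real (Suc k) * d))"
          proof (rule sum_mono)
            fix k assume "k \<in> {..<j}"
            then have "real (Suc k) * d \<le> real j * d" using d by (intro mult_right_mono) auto
            then show "p x0 \<le> p (real (Suc k) * d)"
              using jd t0(2) monotone_onD[OF p(1), of "real (Suc k) * d" x0] pos[of k] x0(1) by simp
          qed
          also have "\<dots> \<le> (\<Sum>k<i. p (real (Suc k) * d))"
            using ji p(2)[OF pos] by (intro sum_mono2) auto
          finally have "\<epsilon> * ((t0 / d - 1) * p x0) \<le> \<epsilon> * (\<Sum>k<i. p (real (Suc k) * d))"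
            using \<epsilon> by (intro mult_left_mono) auto
          with small have 1: "B \<le> \<epsilon> * (\<Sum>k<i. p (real (Suc k) * d))" by simp
          have "0 < real i * d" using False t0 by simp
          then have "ennreal (d * (\<Sum>k<i. p (real (Suc k) * d))) \<le> ennreal (d * (B + (\<Sum>k<i. q (real (Suc k) * d))))"
            using order_trans[OF order_trans[OF lower_sum_le[OF p d] maj] le_upper_sum[OF q d]] by simp
          moreover have "0 \<le> B + (\<Sum>k<i. q (real (Suc k) * d))"
            using B q(2)[OF pos] by (intro add_nonneg_nonneg sum_nonneg) auto
          ultimately have "(\<Sum>k<i. p (real (Suc k) * d)) \<le> B + (\<Sum>k<i. q (real (Suc k) * d))"
            using d by (simp add: ennreal_le_iff)
          with 1 show ?thesis unfolding sum_distrib_left[symmetric] by (simp add: algebra_simps)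
        qed
      qed
      also have "\<dots> \<le> \<sigma> (\<lambda>x. ennreal (q x))"
      proof (rule bfn_mono_pos[OF bfn])
        fix x :: real assume x: "0 < x"
        then obtain k where k: "x \<in> cell d k" using cell_cover[OF d] by auto
        then have "q (real (Suc k) * d) \<le> q x"
          using monotone_onD[OF q(1), of x "real (Suc k) * d"] x pos[of k] by (auto simp: cell_def)
        then show "ennreal (step d N (\<lambda>k. q (real (Suc k) * d)) x) \<le> ennreal (q x)"
          using step_cell[OF d k] by (auto intro: ennreal_leI)
      qed (auto intro!: measurable_lebesgue_posI)
      finally show ?thesis .
    qed
    \<comment> \<open>Lower step functions on different meshes are not ordered. Shifting
      \<open>p\<close> by one mesh width puts it below the lower step function, because
      \<open>x + d\<close> lies past the right end of the cell of \<open>x\<close>, and the shifted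
      functions do increase with \<open>n\<close>. The cutoff at \<open>n\<close> leaves finitely
      many cells.\<close>
    define F where "F = (\<lambda>(n::nat) x. ennreal ((1 - \<epsilon>) * p (x + 1 / real (Suc n))) * indicator {..real n} x)"
    show ?thesis
    proof (rule bfn_le_of_increasing[OF bfn])
      show "F n \<in> borel_measurable lebesgue_pos" for n
        unfolding F_def by (intro measurable_lebesgue_posI) measurable
      show "(\<lambda>x. ennreal (1 - \<epsilon>) * ennreal (p x)) \<in> borel_measurable lebesgue_pos"
        by (intro measurable_lebesgue_posI) measurable
      show "AE x in lebesgue_pos. incseq (\<lambda>n. F n x) \<and> (\<lambda>n. F n x) \<longlonglongrightarrow> ennreal (1 - \<epsilon>) * ennreal (p x)"
        unfolding AE_lebesgue_pos using antimono_AE_right_limit[OF p(1)]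
      proof (rule AE_mp, intro AE_I2 impI conjI)
        fix x :: real assume lim: "0 < x \<longrightarrow> (\<lambda>n. p (x + 1 / real (Suc n))) \<longlonglongrightarrow> p x" and x: "0 < x"
        show "incseq (\<lambda>n. F n x)"
        proof (rule incseq_SucI)
          fix n
          have "p (x + 1 / real (Suc n)) \<le> p (x + 1 / real (Suc (Suc n)))"
            using x by (intro monotone_onD[OF p(1)]) (auto simp: add_pos_pos frac_le)
          then have "ennreal ((1 - \<epsilon>) * p (x + 1 / real (Suc n))) \<le> ennreal ((1 - \<epsilon>) * p (x + 1 / real (Suc (Suc n))))"
            using \<epsilon> by (intro ennreal_leI mult_left_mono) auto
          then show "F n x \<le> F (Suc n) x" unfolding F_def by (intro mult_mono) (auto simp: indicator_def)
        qed
        have "(\<lambda>n. ennreal ((1 - \<epsilon>) * p (x + 1 / real (Suc n)))) \<longlonglongrightarrow> ennreal ((1 - \<epsilon>) * p x)"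
          using lim x by (intro tendsto_ennrealI tendsto_mult tendsto_const) auto
        moreover have "eventually (\<lambda>n. ennreal ((1 - \<epsilon>) * p (x + 1 / real (Suc n))) = F n x) sequentially"
          using eventually_ge_at_top[of "nat \<lceil>x\<rceil>"] unfolding F_def
          by eventually_elim (auto simp: indicator_def)
        ultimately show "(\<lambda>n. F n x) \<longlonglongrightarrow> ennreal (1 - \<epsilon>) * ennreal (p x)"
          using \<epsilon> p(2)[OF x] by (simp add: ennreal_mult tendsto_cong)
      qed
      obtain n0 :: nat where n0: "(B / (\<epsilon> * p x0) + 1) / t0 \<le> real n0" using real_arch_simple by blast
      show "eventually (\<lambda>n. \<sigma> (F n) \<le> \<sigma> (\<lambda>x. ennreal (q x))) sequentially"
        using eventually_ge_at_top[of n0]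
      proof eventually_elim
        fix n assume n: "n0 \<le> n"
        define d where "d = 1 / real (Suc n)"
        have d: "0 < d" by (simp add: d_def)
        have "(B / (\<epsilon> * p x0) + 1) / t0 \<le> real (Suc n)" using n0 n by simp
        then have "B / (\<epsilon> * p x0) \<le> t0 / d - 1" using t0(1) by (simp add: d_def field_simps)
        then have small: "B \<le> \<epsilon> * ((t0 / d - 1) * p x0)"
          using \<epsilon> x0 by (simp add: pos_divide_le_eq mult.assoc mult.left_commute)
        \<comment> \<open>The interval up to \<open>n\<close> consists of \<open>n * Suc n\<close>
          cells of width \<open>1 / Suc n\<close>.\<close>
        have "\<sigma> (F n) \<le> \<sigma> (\<lambda>x. ennreal (step d (n * Suc n) (\<lambda>k. (1 - \<epsilon>) * p (real (Suc k) * d)) x))"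
        proof (rule bfn_mono_pos[OF bfn])
          fix x :: real assume x: "0 < x"
          then obtain k where k: "x \<in> cell d k" using cell_cover[OF d] by auto
          show "F n x \<le> ennreal (step d (n * Suc n) (\<lambda>k. (1 - \<epsilon>) * p (real (Suc k) * d)) x)"
          proof (cases "x \<le> real n")
            case True
            have "real k * d < x" "x \<le> real (Suc k) * d" using k by (auto simp: cell_def)
            with True have "real k * d < real n" by simp
            then have "real k < real n * real (Suc n)" by (simp add: d_def field_simps)
            then have "k < n * Suc n" by (metis of_nat_less_iff of_nat_mult)
            moreover have "p (x + d) \<le> p (real (Suc k) * d)"
              using \<open>real k * d < x\<close> d x by (intro monotone_onD[OF p(1)]) (auto simp: algebra_simps add_pos_pos intro: add_pos_nonneg)
            moreover have "F n x = ennreal ((1 - \<epsilon>) * p (x + d))" using True by (simp add: F_def d_def)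
            ultimately show ?thesis
              using \<epsilon> step_cell[OF d k] by (auto intro!: ennreal_leI mult_left_mono)
          qed (simp add: F_def)
        qed (auto simp: F_def intro!: measurable_lebesgue_posI)
        also have "\<dots> \<le> \<sigma> (\<lambda>x. ennreal (q x))" by (rule step_le[OF d small])
        finally show "\<sigma> (F n) \<le> \<sigma> (\<lambda>x. ennreal (q x))" .
      qed
    qed
  qed
  \<comment> \<open>Here \<open>\<epsilon>\<close> is \<open>1 / (n + 2)\<close>; with
    \<open>n + 1\<close> the condition \<open>\<epsilon> < 1\<close> of \<open>key\<close> would
    fail at \<open>n = 0\<close>.\<close>
  define G where "G = (\<lambda>n x. ennreal (1 - inverse (real (Suc (Suc n)))) * ennreal (p x))"
  show ?thesis
  proof (rule bfn_le_of_increasing[OF bfn, where F = G])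
    show "G n \<in> borel_measurable lebesgue_pos" for n
      unfolding G_def by (intro measurable_lebesgue_posI) measurable
    show "AE x in lebesgue_pos. incseq (\<lambda>n. G n x) \<and> (\<lambda>n. G n x) \<longlonglongrightarrow> ennreal (p x)"
    proof (intro AE_I2 conjI)
      fix x assume "x \<in> space lebesgue_pos"
      then have px: "0 \<le> p x" using p(2) by (simp add: space_restrict_space)
      show "incseq (\<lambda>n. G n x)" unfolding G_def
        by (intro incseq_SucI mult_right_mono ennreal_leI) (auto)
      have "(\<lambda>n. (1 - inverse (real (Suc (Suc n)))) * p x) \<longlonglongrightarrow> (1 - 0) * p x"
        by (intro tendsto_intros LIMSEQ_Suc[OF LIMSEQ_inverse_real_of_nat])
      then have "(\<lambda>n. ennreal ((1 - inverse (real (Suc (Suc n)))) * p x)) \<longlonglongrightarrow> ennreal (p x)"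
        by (intro tendsto_ennrealI) simp
      then show "(\<lambda>n. G n x) \<longlonglongrightarrow> ennreal (p x)"
        unfolding G_def using px by (subst (asm) ennreal_mult) (auto simp: field_simps)
    qed
    show "\<forall>\<^sub>F n in sequentially. \<sigma> (G n) \<le> \<sigma> (\<lambda>x. ennreal (q x))"
      unfolding G_def by (intro always_eventually allI key) (auto simp: field_simps)
  qed (auto intro!: measurable_lebesgue_posI)
qed

section \<open>Step functions with heights in arbitrary order\<close>

lemma nn_integral_Ioc_split:
  fixes f :: "real \<Rightarrow> ennreal"
  assumes "0 \<le> a" "a \<le> b" and [measurable]: "f \<in> borel_measurable borel"
  shows "(\<integral>\<^sup>+x\<in>{0<..b}. f x \<partial>lborel) = (\<integral>\<^sup>+x\<in>{0<..a}. f x \<partial>lborel) + (\<integral>\<^sup>+x\<in>{a<..b}. f x \<partial>lborel)"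
  using assms(1,2)
  by (subst nn_integral_add[symmetric]) (auto intro!: nn_integral_cong simp: indicator_def)

lemma ex_sorting_permutation:
  fixes a :: "nat \<Rightarrow> real"
  shows "\<exists>\<pi>. \<pi> permutes {..<N} \<and> (\<forall>i j. i \<le> j \<longrightarrow> j < N \<longrightarrow> a (\<pi> j) \<le> a (\<pi> i))"
proof -
  define xs where "xs = map a [0..<N]"
  define ys where "ys = rev (sort xs)"
  have len: "length xs = N" "length ys = N" by (auto simp: xs_def ys_def)
  have "mset ys = mset xs" by (simp add: ys_def)
  then obtain \<pi> where \<pi>: "\<pi> permutes {..<length xs}" "permute_list \<pi> xs = ys"
    by (rule mset_eq_permutation)
  have "ys ! i = a (\<pi> i)" if "i < N" for i
    using that permute_list_nth[OF \<pi>(1), of i] \<pi>(2) permutes_in_image[OF \<pi>(1), of i] len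
    by (auto simp: xs_def)
  moreover have "ys ! j \<le> ys ! i" if "i \<le> j" "j < N" for i j
    using that len by (intro sorted_rev_nth_mono) (auto simp: ys_def)
  ultimately show ?thesis using \<pi>(1) len by auto
qed

text \<open>The primitive of a decreasing \<open>q\<close> is concave, so it dominates the piecewise linear
  primitive of a step function as soon as it does so at the nodes.\<close>

lemma step_integral_le:
  fixes q :: "real \<Rightarrow> real"
  assumes d: "0 < d" and a: "\<forall>k<N. 0 \<le> a k"
    and q: "antimono_on {0<..} q" "\<And>x. 0 < x \<Longrightarrow> 0 \<le> q x"
    and [measurable]: "q \<in> borel_measurable borel"
    and nodes: "\<And>i. i \<le> N \<Longrightarrow> ennreal (d * sum a {..<i}) \<le> (\<integral>\<^sup>+x\<in>{0<..real i * d}. ennreal (q x) \<partial>lborel)"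
    and t: "0 < t"
  shows "(\<integral>\<^sup>+x\<in>{0<..t}. ennreal (step d N a x) \<partial>lborel) \<le> (\<integral>\<^sup>+x\<in>{0<..t}. ennreal (q x) \<partial>lborel)"
proof -
  obtain i where i: "t \<in> cell d i" using cell_cover[OF d t] by auto
  then have it: "real i * d < t" "t \<le> real (Suc i) * d" by (auto simp: cell_def)
  have id: "0 \<le> real i * d" using d by simp
  show ?thesis
  proof (cases "i < N")
    case False
    have "(\<integral>\<^sup>+x\<in>{0<..t}. ennreal (step d N a x) \<partial>lborel) \<le> (\<integral>\<^sup>+x. ennreal (step d N a x) \<partial>lborel)"
      by (intro nn_integral_mono) (auto simp: indicator_def)
    also have "\<dots> \<le> (\<integral>\<^sup>+x\<in>{0<..real N * d}. ennreal (q x) \<partial>lborel)"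
      using nodes[of N] nn_integral_step[OF d a] by simp
    also have "\<dots> \<le> (\<integral>\<^sup>+x\<in>{0<..t}. ennreal (q x) \<partial>lborel)"
    proof -
      have "real N * d \<le> real i * d" using False d by (intro mult_right_mono) auto
      then show ?thesis using it by (intro nn_integral_mono) (auto simp: indicator_def)
    qed
    finally show ?thesis .
  next
    case True
    define c where "c = a i"
    have c: "0 \<le> c" using a True by (simp add: c_def)
    have ai: "\<forall>k<i. 0 \<le> a k" using a True by auto
    have sumi: "0 \<le> d * sum a {..<i}" using ai d by (auto intro!: mult_nonneg_nonneg sum_nonneg)
    have tc: "0 \<le> (t - real i * d) * c" "0 \<le> (real (Suc i) * d - t) * c" using it c by auto
    have "(\<integral>\<^sup>+x\<in>{0<..t}. ennreal (step d N a x) \<partial>lborel)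
        \<le> (\<integral>\<^sup>+x. ennreal (step d i a x) + ennreal c * indicator {real i * d<..t} x \<partial>lborel)"
    proof (rule nn_integral_mono)
      fix x :: real
      show "ennreal (step d N a x) * indicator {0<..t} x \<le> ennreal (step d i a x) + ennreal c * indicator {real i * d<..t} x"
      proof (cases "x \<in> {0<..t}")
        case x: True
        then obtain k where k: "x \<in> cell d k" using cell_cover[OF d] by auto
        have "real k * d < real (Suc i) * d" using k x it by (auto simp: cell_def)
        then have "k \<le> i" using d by (simp add: mult_less_cancel_right)
        moreover have "k = i \<Longrightarrow> real i * d < x" using k by (auto simp: cell_def)
        ultimately show ?thesis
          unfolding step_cell[OF d k] using x True by (auto simp: c_def)
      qed simp
    qed
    also have "\<dots> = ennreal (d * sum a {..<i}) + ennreal c * ennreal (t - real i * d)"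
      using it by (subst nn_integral_add) (auto simp: nn_integral_step[OF d ai] nn_integral_cmult_indicator)
    also have "\<dots> = ennreal (d * sum a {..<i} + (t - real i * d) * c)"
      using sumi tc it c by (simp add: ennreal_mult mult.commute)
    finally have *: "(\<integral>\<^sup>+x\<in>{0<..t}. ennreal (step d N a x) \<partial>lborel) \<le> ennreal (d * sum a {..<i} + (t - real i * d) * c)" .
    show ?thesis
    \<comment> \<open>At the nodes the comparison is known. If \<open>c \<le> q t\<close>, then
      \<open>q\<close> is at least \<open>c\<close> between the node before \<open>t\<close> and
      \<open>t\<close>, and the comparison extends forward. Otherwise \<open>q\<close> is below
      \<open>c\<close> beyond \<open>t\<close>, and it is pulled back from the next node by
      cancelling \<open>(real (Suc i) * d - t) * c\<close>.\<close>
    proof (cases "c \<le> q t")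
      case True
      note *
      also have "ennreal (d * sum a {..<i} + (t - real i * d) * c) = ennreal (d * sum a {..<i}) + ennreal ((t - real i * d) * c)"
        using sumi tc by simp
      also have "\<dots> \<le> (\<integral>\<^sup>+x\<in>{0<..real i * d}. ennreal (q x) \<partial>lborel) + (\<integral>\<^sup>+x\<in>{real i * d<..t}. ennreal (q x) \<partial>lborel)"
      proof (intro add_mono nodes)
        have "ennreal ((t - real i * d) * c) = (\<integral>\<^sup>+x. ennreal c * indicator {real i * d<..t} x \<partial>lborel)"
          using it c by (simp add: nn_integral_cmult_indicator ennreal_mult mult.commute)
        also have "\<dots> \<le> (\<integral>\<^sup>+x\<in>{real i * d<..t}. ennreal (q x) \<partial>lborel)"
        proof (rule nn_integral_mono)
          fix x :: real
          show "ennreal c * indicator {real i * d<..t} x \<le> ennreal (q x) * indicator {real i * d<..t} x"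
          proof (cases "x \<in> {real i * d<..t}")
            case x: True
            then have "0 < x" using id by (auto intro: le_less_trans)
            then have "q t \<le> q x" using x by (intro monotone_onD[OF q(1)]) auto
            with True x show ?thesis by (auto intro: ennreal_leI)
          qed simp
        qed
        finally show "ennreal ((t - real i * d) * c) \<le> (\<integral>\<^sup>+x\<in>{real i * d<..t}. ennreal (q x) \<partial>lborel)" .
      qed (use \<open>i < N\<close> in simp)
      also have "\<dots> = (\<integral>\<^sup>+x\<in>{0<..t}. ennreal (q x) \<partial>lborel)"
        using id it by (intro nn_integral_Ioc_split[symmetric]) auto
      finally show ?thesis .
    next
      case False
      have "ennreal ((real (Suc i) * d - t) * c) + ennreal (d * sum a {..<i} + (t - real i * d) * c)
          = ennreal (d * sum a {..<Suc i})"
        using sumi tc by (subst ennreal_plus[symmetric]) (auto simp: c_def algebra_simps)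
      also have "\<dots> \<le> (\<integral>\<^sup>+x\<in>{0<..real (Suc i) * d}. ennreal (q x) \<partial>lborel)"
        using \<open>i < N\<close> by (intro nodes) auto
      also have "\<dots> = (\<integral>\<^sup>+x\<in>{0<..t}. ennreal (q x) \<partial>lborel) + (\<integral>\<^sup>+x\<in>{t<..real (Suc i) * d}. ennreal (q x) \<partial>lborel)"
        using t it by (intro nn_integral_Ioc_split) auto
      also have "(\<integral>\<^sup>+x\<in>{t<..real (Suc i) * d}. ennreal (q x) \<partial>lborel)
          \<le> (\<integral>\<^sup>+x. ennreal c * indicator {t<..real (Suc i) * d} x \<partial>lborel)"
      proof (rule nn_integral_mono)
        fix x :: real
        show "ennreal (q x) * indicator {t<..real (Suc i) * d} x \<le> ennreal c * indicator {t<..real (Suc i) * d} x"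
        proof (cases "x \<in> {t<..real (Suc i) * d}")
          case x: True
          then have "q x \<le> q t" using t by (intro monotone_onD[OF q(1)]) auto
          with False x show ?thesis by (auto intro: ennreal_leI)
        qed simp
      qed
      also have "\<dots> = ennreal ((real (Suc i) * d - t) * c)"
        using it c by (subst nn_integral_cmult_indicator) (auto simp: ennreal_mult mult.commute)
      finally have "ennreal ((real (Suc i) * d - t) * c) + ennreal (d * sum a {..<i} + (t - real i * d) * c)
          \<le> ennreal ((real (Suc i) * d - t) * c) + (\<integral>\<^sup>+x\<in>{0<..t}. ennreal (q x) \<partial>lborel)"
        by (simp add: add.commute add_left_mono)
      then have "ennreal (d * sum a {..<i} + (t - real i * d) * c) \<le> (\<integral>\<^sup>+x\<in>{0<..t}. ennreal (q x) \<partial>lborel)"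
        unfolding ennreal_add_left_cancel_le by simp
      with * show ?thesis by (rule order_trans)
    qed
  qed
qed

text \<open>Sorting the heights leaves the norm unchanged. Since the hypothesis ranges over all
  index sets, it also bounds the sums of the largest heights, in whatever order they occur;
  \<open>step_integral_le\<close> turns this into majorization by \<open>q\<close>.\<close>

lemma step_norm_le:
  fixes q :: "real \<Rightarrow> real"
  assumes ri: "ri_norm lebesgue_pos \<sigma>" and d: "0 < d" and a: "\<forall>k<N. 0 \<le> a k"
    and q: "antimono_on {0<..} q" "\<And>x. 0 < x \<Longrightarrow> 0 \<le> q x" "\<And>x. 0 < x \<Longrightarrow> q x \<le> B"
    and [measurable]: "q \<in> borel_measurable borel"
    and sums: "\<And>K. K \<subseteq> {..<N} \<Longrightarrow>
      ennreal (d * sum a K) \<le> (\<integral>\<^sup>+x\<in>{0<..real (card K) * d}. ennreal (q x) \<partial>lborel)"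
  shows "\<sigma> (\<lambda>x. ennreal (step d N a x)) \<le> \<sigma> (\<lambda>x. ennreal (q x))"
proof -
  obtain \<pi> where \<pi>: "\<pi> permutes {..<N}" "\<And>i j. i \<le> j \<Longrightarrow> j < N \<Longrightarrow> a (\<pi> j) \<le> a (\<pi> i)"
    using ex_sorting_permutation[of N a] by blast
  have pos: "\<forall>k<N. 0 \<le> (a \<circ> \<pi>) k" using a permutes_in_image[OF \<pi>(1)] by simp
  have "\<sigma> (\<lambda>x. ennreal (step d N a x)) = \<sigma> (\<lambda>x. ennreal (step d N (a \<circ> \<pi>) x))"
    using step_norm_permute[OF ri d a \<pi>(1)] by simp
  also have "\<dots> \<le> \<sigma> (\<lambda>x. ennreal (q x))"
  proof (rule hardy_littlewood_polya[OF ri _ _ q])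
    show "antimono_on {0<..} (step d N (a \<circ> \<pi>))"
    proof (rule monotone_onI)
      fix x y :: real assume "x \<in> {0<..}" "y \<in> {0<..}" "x \<le> y"
      then obtain j k where jk: "x \<in> cell d j" "y \<in> cell d k" using cell_cover[OF d] by (metis greaterThan_iff)
      have "real j * d < real (Suc k) * d" using jk \<open>x \<le> y\<close> by (auto simp: cell_def)
      then have "j \<le> k" using d by (simp add: mult_less_cancel_right)
      then show "step d N (a \<circ> \<pi>) y \<le> step d N (a \<circ> \<pi>) x"
        unfolding step_cell[OF d jk(1)] step_cell[OF d jk(2)] using \<pi>(2)[of j k] pos by auto
    qed
    show "0 \<le> step d N (a \<circ> \<pi>) x" for x using pos by (rule step_nonneg)
    show "(\<integral>\<^sup>+x\<in>{0<..t}. ennreal (step d N (a \<circ> \<pi>) x) \<partial>lborel) \<le> (\<integral>\<^sup>+x\<in>{0<..t}. ennreal (q x) \<partial>lborel)"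
      if "0 < t" for t
    proof (rule step_integral_le[OF d pos q(1,2) _ _ that])
      fix i assume i: "i \<le> N"
      have inj: "inj_on \<pi> {..<i}" using permutes_inj[OF \<pi>(1)] by (rule inj_on_subset) simp
      have "\<pi> ` {..<i} \<subseteq> \<pi> ` {..<N}" using i by (intro image_mono) simp
      then have "\<pi> ` {..<i} \<subseteq> {..<N}" unfolding permutes_image[OF \<pi>(1)] .
      from sums[OF this] show "ennreal (d * sum (a \<circ> \<pi>) {..<i}) \<le> (\<integral>\<^sup>+x\<in>{0<..real i * d}. ennreal (q x) \<partial>lborel)"
        by (simp add: sum.reindex[OF inj] card_image[OF inj])
    qed auto
  qed auto
  finally show ?thesis .
qed

subsection \<open>Decreasing rearrangements\<close>

lemma less_rearrD: "t < rearr M u s \<Longrightarrow> ennreal s < distribution M u t"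
  unfolding rearr_def by (metis Inf_lower mem_Collect_eq not_le)

lemma rearr_leI: "distribution M u t \<le> ennreal s \<Longrightarrow> rearr M u s \<le> t"
  unfolding rearr_def by (intro Inf_lower) simp

lemma rearr_antimono: "s \<le> s' \<Longrightarrow> rearr M u s' \<le> rearr M u s"
  unfolding rearr_def by (intro Inf_superset_mono) (auto intro: order_trans ennreal_leI)

lemma distribution_antimono:
  assumes "u \<in> borel_measurable M" "t \<le> t'"
  shows "distribution M u t' \<le> distribution M u t"
  unfolding distribution_def using assms by (intro emeasure_mono) (auto intro: le_less_trans)

lemma distribution_mono_AE:
  assumes [measurable]: "u \<in> borel_measurable M" "v \<in> borel_measurable M" and "AE x in M. u x \<le> v x"
  shows "distribution M u t \<le> distribution M v t"
  unfolding distribution_def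
proof (rule emeasure_mono_AE)
  show "AE x in M. x \<in> {x \<in> space M. t < u x} \<longrightarrow> x \<in> {x \<in> space M. t < v x}"
    using assms(3) by eventually_elim (auto intro: less_le_trans)
qed simp

lemma rearr_mono_AE:
  assumes "u \<in> borel_measurable M" "v \<in> borel_measurable M" "AE x in M. u x \<le> v x"
  shows "rearr M u s \<le> rearr M v s"
  unfolding rearr_def using distribution_mono_AE[OF assms]
  by (intro Inf_superset_mono) (auto intro: order_trans)

lemma rearr_le_bound: "(\<And>x. x \<in> space M \<Longrightarrow> u x \<le> B) \<Longrightarrow> rearr M u s \<le> B"
proof (rule rearr_leI)
  assume "\<And>x. x \<in> space M \<Longrightarrow> u x \<le> B"
  then have "{x \<in> space M. B < u x} = {}" by (auto simp: not_less)
  then have "emeasure M {x \<in> space M. B < u x} = 0" by (simp only: emeasure_empty)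
  then show "distribution M u B \<le> ennreal s" by (simp add: distribution_def)
qed

text \<open>The infimum is attained: levels decreasing to it keep the bound, by continuity of the
  measure along increasing sets.\<close>

lemma distribution_rearr_le:
  assumes [measurable]: "u \<in> borel_measurable M"
  shows "distribution M u (rearr M u s) \<le> ennreal s"
proof (cases "rearr M u s = \<infinity>")
  case True
  then show ?thesis by (simp add: distribution_def)
next
  case False
  define r where "r = rearr M u s"
  define e where "e = (\<lambda>n. r + ennreal (1 / real (Suc n)))"
  have r: "r < \<infinity>" using False by (simp add: r_def less_top)
  have "(\<lambda>n. 1 / real (Suc n)) \<longlonglongrightarrow> 0" using LIMSEQ_inverse_real_of_nat by (simp add: inverse_eq_divide)
  then have "e \<longlonglongrightarrow> r + ennreal 0" unfolding e_def by (intro tendsto_add tendsto_const tendsto_ennrealI)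
  then have lim: "e \<longlonglongrightarrow> r" by simp
  have dec: "e (Suc n) \<le> e n" for n
    unfolding e_def by (intro add_left_mono ennreal_leI) (auto simp: frac_le)
  have small: "distribution M u (e n) \<le> ennreal s" for n
  proof -
    have "r + 0 < e n" unfolding e_def using r
      by (subst ennreal_add_left_cancel_less) auto
    then have "r < e n" by simp
    then obtain t where "distribution M u t \<le> ennreal s" "t < e n"
      unfolding r_def rearr_def Inf_less_iff by auto
    then show ?thesis using distribution_antimono[OF assms, of t "e n"] by (meson less_imp_le order_trans)
  qed
  have "{x \<in> space M. r < u x} = (\<Union>n. {x \<in> space M. e n < u x})"
  proof (intro set_eqI iffI)
    fix x assume "x \<in> {x \<in> space M. r < u x}"
    then have "eventually (\<lambda>n. e n < u x) sequentially" "x \<in> space M" using order_tendstoD(2)[OF lim] by auto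
    then show "x \<in> (\<Union>n. {x \<in> space M. e n < u x})" using eventually_happens by fastforce
  next
    fix x assume "x \<in> (\<Union>n. {x \<in> space M. e n < u x})"
    moreover have "r \<le> e n" for n by (simp add: e_def)
    ultimately show "x \<in> {x \<in> space M. r < u x}" by (auto intro: le_less_trans)
  qed
  then have "distribution M u r = emeasure M (\<Union>n. {x \<in> space M. e n < u x})" by (simp add: distribution_def)
  also have "\<dots> = (SUP n. emeasure M {x \<in> space M. e n < u x})"
    using dec by (intro SUP_emeasure_incseq[symmetric] incseq_SucI) (auto intro: le_less_trans)
  also have "\<dots> \<le> ennreal s" using small by (intro SUP_least) (simp add: distribution_def)
  finally show ?thesis by (simp add: r_def)
qed

lemma borel_measurable_rearr:
  assumes "\<And>s. rearr M u s < \<infinity>"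
  shows "(\<lambda>s. enn2real (rearr M u s)) \<in> borel_measurable borel"
proof -
  have "mono (\<lambda>s. - enn2real (rearr M u s))"
    using assms by (intro monoI) (auto intro!: enn2real_mono rearr_antimono)
  from borel_measurable_uminus[OF borel_measurable_mono[OF this]] show ?thesis by simp
qed

section \<open>Consequences of resonance\<close>

lemma rearr_indicator:
  assumes "E \<in> sets M"
  shows "rearr M (absf (indicator E)) s = (if ennreal s < emeasure M E then 1 else 0)"
proof -
  have eq: "distribution M (absf (indicator E)) t = (if t < 1 then emeasure M E else 0)" for t
  proof -
    have "{x \<in> space M. t < absf (indicator E) x} = (if t < 1 then E else {})"
      using sets.sets_into_space[OF assms] by (auto simp: absf_def indicator_def)
    then show ?thesis by (simp add: distribution_def)
  qed
  have "{t. distribution M (absf (indicator E)) t \<le> ennreal s} = (if ennreal s < emeasure M E then {1..} else UNIV)"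
    by (auto simp: eq not_less)
  then show ?thesis by (simp add: rearr_def bot_ennreal)
qed

lemma absf_mult: "absf (\<lambda>x. f x * g x) x = absf f x * absf g x"
  by (simp add: absf_def abs_mult ennreal_mult)

lemma borel_measurable_absf [measurable (raw)]: "f \<in> borel_measurable M \<Longrightarrow> absf f \<in> borel_measurable M"
  unfolding absf_def by measurable

text \<open>\<open>g\<close> itself is a competitor in the supremum.\<close>

lemma resonant_hardy_littlewood:
  assumes "resonant M" "f \<in> borel_measurable M" "g \<in> borel_measurable M"
  shows "(\<integral>\<^sup>+x. absf (\<lambda>x. f x * g x) x \<partial>M) \<le> (\<integral>\<^sup>+s\<in>{0<..}. rearr M (absf f) s * rearr M (absf g) s \<partial>lborel)"
proof -
  have "(\<integral>\<^sup>+s\<in>{0<..}. rearr M (absf f) s * rearr M (absf g) s \<partial>lborel) =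
        (SUP g'\<in>{g' \<in> borel_measurable M. equimeasurable M g' g}. \<integral>\<^sup>+x. absf (\<lambda>x. f x * g' x) x \<partial>M)"
    using assms unfolding resonant_def by blast
  then show ?thesis using assms(3) by (auto intro: SUP_upper simp: equimeasurable_def)
qed

lemma resonant_set_integral_le:
  assumes "resonant M" "f \<in> borel_measurable M" "E \<in> sets M" "emeasure M E \<le> ennreal t"
  shows "(\<integral>\<^sup>+x\<in>E. absf f x \<partial>M) \<le> (\<integral>\<^sup>+s\<in>{0<..t}. rearr M (absf f) s \<partial>lborel)"
proof -
  have "(\<integral>\<^sup>+x\<in>E. absf f x \<partial>M) = (\<integral>\<^sup>+x. absf (\<lambda>x. f x * indicator E x) x \<partial>M)"
    by (intro nn_integral_cong) (auto simp: absf_def indicator_def)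
  also have "\<dots> \<le> (\<integral>\<^sup>+s\<in>{0<..}. rearr M (absf f) s * rearr M (absf (indicator E)) s \<partial>lborel)"
    using assms by (intro resonant_hardy_littlewood) auto
  also have "\<dots> \<le> (\<integral>\<^sup>+s\<in>{0<..t}. rearr M (absf f) s \<partial>lborel)"
  proof (rule nn_integral_mono)
    fix s :: real
    have "s \<le> t" if "ennreal s < emeasure M E" "0 < s"
      using less_le_trans[OF that(1) assms(4)] that(2) by (simp add: ennreal_less_iff)
    then show "rearr M (absf f) s * rearr M (absf (indicator E)) s * indicator {0<..} s
        \<le> rearr M (absf f) s * indicator {0<..t} s"
      unfolding rearr_indicator[OF assms(3)] by (auto simp: indicator_def)
  qed
  finally show ?thesis .
qed

text \<open>Tested against an indicator of measure \<open>t\<close>, the rearrangement of the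
  product becomes a supremum of integrals of \<open>f * g * g'\<close>, where \<open>g'\<close> is
  at most 1 in absolute value a.e. and nonzero on a set of measure \<open>t\<close>. Grouping
  \<open>g'\<close> with \<open>f\<close> makes the rearrangement of \<open>f * g'\<close> vanish
  from \<open>t\<close> on, and \<open>resonant_hardy_littlewood\<close> concludes.\<close>

lemma resonant_rearr_mult:
  assumes res: "resonant M" and [measurable]: "f \<in> borel_measurable M" "g \<in> borel_measurable M"
    and F: "F \<in> sets M" "emeasure M F = ennreal t" and t: "0 < t"
  shows "(\<integral>\<^sup>+s\<in>{0<..t}. rearr M (absf (\<lambda>x. f x * g x)) s \<partial>lborel)
    \<le> (\<integral>\<^sup>+s\<in>{0<..t}. rearr M (absf f) s * rearr M (absf g) s \<partial>lborel)"
proof -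
  note [measurable] = F(1)
  have "(\<integral>\<^sup>+s\<in>{0<..t}. rearr M (absf (\<lambda>x. f x * g x)) s \<partial>lborel)
      \<le> (\<integral>\<^sup>+s\<in>{0<..}. rearr M (absf (\<lambda>x. f x * g x)) s * rearr M (absf (indicator F)) s \<partial>lborel)"
    unfolding rearr_indicator[OF F(1)] F(2)
    \<comment> \<open>The rearranged indicator is 1 for \<open>s < t\<close> only, while the left
      integral includes \<open>s = t\<close>; the singleton is null.\<close>
    by (rule nn_integral_mono_AE, rule AE_mp[OF AE_lborel_singleton[of t]])
       (auto simp: indicator_def ennreal_less_iff)
  also have "\<dots> = (SUP g'\<in>{g' \<in> borel_measurable M. equimeasurable M g' (indicator F)}.
      \<integral>\<^sup>+x. absf (\<lambda>x. f x * g x * g' x) x \<partial>M)"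
    using res unfolding resonant_def by (auto intro!: borel_measurable_times)
  also have "\<dots> \<le> (\<integral>\<^sup>+s\<in>{0<..t}. rearr M (absf f) s * rearr M (absf g) s \<partial>lborel)"
  proof (rule SUP_least)
    fix g' assume "g' \<in> {g' \<in> borel_measurable M. equimeasurable M g' (indicator F)}"
    then have [measurable]: "g' \<in> borel_measurable M" and eq: "equimeasurable M g' (indicator F)" by auto
    have d0: "distribution M (absf g') 0 = ennreal t"
    proof -
      have "{x \<in> space M. 0 < absf (indicator F) x} = F"
        using sets.sets_into_space[OF F(1)] by (auto simp: absf_def indicator_def)
      then show ?thesis
        using eq[unfolded equimeasurable_def, rule_format, of 0] F(2) by (simp add: distribution_def)
    qed
    have "emeasure M {x \<in> space M. 1 < absf g' x} = 0"
    proof -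
      have "{x \<in> space M. 1 < absf (indicator F) x} = {}" by (auto simp: absf_def indicator_def)
      then have "emeasure M {x \<in> space M. 1 < absf (indicator F) x} = 0" by (simp only: emeasure_empty)
      then show ?thesis
        using eq[unfolded equimeasurable_def, rule_format, of 1] by (simp add: distribution_def)
    qed
    then have le1: "AE x in M. absf g' x \<le> 1"
      by (intro AE_I[where N = "{x \<in> space M. 1 < absf g' x}"]) (auto simp: not_le)
    have r1: "rearr M (absf (\<lambda>x. f x * g' x)) s \<le> rearr M (absf f) s" for s
    proof (rule rearr_mono_AE)
      show "AE x in M. absf (\<lambda>x. f x * g' x) x \<le> absf f x"
        using le1 by eventually_elim (metis absf_mult mult.right_neutral mult_left_mono zero_le)
    qed auto
    have r2: "rearr M (absf (\<lambda>x. f x * g' x)) s \<le> 0" if "t \<le> s" for s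
    proof (rule rearr_leI)
      have "distribution M (absf (\<lambda>x. f x * g' x)) 0 \<le> distribution M (absf g') 0"
        unfolding distribution_def by (intro emeasure_mono) (auto simp: absf_def)
      also have "\<dots> \<le> ennreal s" using d0 that by (simp add: ennreal_leI)
      finally show "distribution M (absf (\<lambda>x. f x * g' x)) 0 \<le> ennreal s" .
    qed
    have "(\<integral>\<^sup>+x. absf (\<lambda>x. f x * g x * g' x) x \<partial>M) = (\<integral>\<^sup>+x. absf (\<lambda>x. (f x * g' x) * g x) x \<partial>M)"
      by (simp add: mult_ac)
    also have "\<dots> \<le> (\<integral>\<^sup>+s\<in>{0<..}. rearr M (absf (\<lambda>x. f x * g' x)) s * rearr M (absf g) s \<partial>lborel)"
      by (rule resonant_hardy_littlewood[OF res]) measurable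
    also have "\<dots> \<le> (\<integral>\<^sup>+s\<in>{0<..t}. rearr M (absf f) s * rearr M (absf g) s \<partial>lborel)"
    proof (rule nn_integral_mono)
      fix s :: real
      show "rearr M (absf (\<lambda>x. f x * g' x)) s * rearr M (absf g) s * indicator {0<..} s
        \<le> rearr M (absf f) s * rearr M (absf g) s * indicator {0<..t} s"
        using r1[of s] r2[of s] by (cases "s \<le> t") (auto simp: indicator_def intro: mult_right_mono)
    qed
    finally show "(\<integral>\<^sup>+x. absf (\<lambda>x. f x * g x * g' x) x \<partial>M) \<le> \<dots>" .
  qed
  finally show ?thesis .
qed

subsection \<open>The coarea inequality\<close>

lemma mem_nbhd_iff: "x \<in> nbhd A h \<longleftrightarrow> (\<exists>a\<in>A. dist x a < h)"
  unfolding nbhd_def by (auto simp: INF_less_iff ennreal_less_iff)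

text \<open>Each superlevel set is a union of open balls, by symmetry of the distance, so the
  supremum is lower semicontinuous for arbitrary \<open>v\<close>.\<close>

lemma borel_measurable_SUP_ball:
  fixes v :: "'a::metric_space \<Rightarrow> ennreal"
  shows "(\<lambda>x. SUP y\<in>ball x h. v y) \<in> borel_measurable borel"
proof (rule borel_measurableI_greater)
  fix c :: ennreal
  have "{x \<in> space borel. c < (SUP y\<in>ball x h. v y)} = (\<Union>y\<in>{y. c < v y}. ball y h)"
    by (auto simp: less_SUP_iff dist_commute)
  then show "{x \<in> space borel. c < (SUP y\<in>ball x h. v y)} \<in> sets borel"
    by (simp only:) (intro borel_open open_UN ballI open_ball)
qed

text \<open>For fixed \<open>y\<close> the quotient is continuous in \<open>x\<close> away from
  \<open>y\<close>, so its suprema over punctured balls are lower semicontinuous. They shrink with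
  the radius, so the infimum over radii may be taken along \<open>1 / Suc n\<close>.\<close>

lemma borel_measurable_grad_mod:
  fixes f :: "'a::metric_space \<Rightarrow> real"
  assumes "continuous_on UNIV f"
  shows "grad_mod f \<in> borel_measurable borel"
proof -
  define S where "S = (\<lambda>e x. SUP y\<in>ball x e - {x}. ennreal (\<bar>f x - f y\<bar> / dist x y))"
  have S: "S e \<in> borel_measurable borel" for e
  proof (rule borel_measurableI_greater)
    fix c :: ennreal
    define g where "g = (\<lambda>y x. \<bar>f x - f y\<bar> / dist x y)"
    have "{x \<in> space borel. c < S e x} = (\<Union>y. {x \<in> ball y e - {y}. c < ennreal (g y x)})"
      unfolding S_def g_def by (auto simp: less_SUP_iff dist_commute)
    moreover have "open {x \<in> ball y e - {y}. c < ennreal (g y x)}" for y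
    proof -
      have o: "open (ball y e - {y})" by auto
      have "continuous_on (ball y e - {y}) (\<lambda>x. ennreal (g y x))"
        unfolding g_def using continuous_on_subset[OF assms subset_UNIV, of "ball y e - {y}"]
        by (intro continuous_intros continuous_on_ennreal) auto
      then have "open ((\<lambda>x. ennreal (g y x)) -` {c<..} \<inter> (ball y e - {y}))"
        unfolding continuous_on_open_vimage[OF o] by (simp only: open_greaterThan)
      moreover have "(\<lambda>x. ennreal (g y x)) -` {c<..} \<inter> (ball y e - {y}) = {x \<in> ball y e - {y}. c < ennreal (g y x)}"
        by auto
      ultimately show ?thesis by simp
    qed
    ultimately show "{x \<in> space borel. c < S e x} \<in> sets borel" by (auto intro!: borel_open)
  qed
  have "grad_mod f x = (INF n. S (1 / real (Suc n)) x)" for x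
  proof -
    have "grad_mod f x = (INF e\<in>{0<..}. S e x)" unfolding grad_mod_def Limsup_at S_def ..
    also have "\<dots> = (INF n. S (1 / real (Suc n)) x)"
    proof (rule antisym)
      show "(INF e\<in>{0<..}. S e x) \<le> (INF n. S (1 / real (Suc n)) x)"
        by (intro INF_greatest INF_lower) auto
      show "(INF n. S (1 / real (Suc n)) x) \<le> (INF e\<in>{0<..}. S e x)"
      proof (rule INF_greatest)
        fix e :: real assume "e \<in> {0<..}"
        then obtain n where n: "1 / real (Suc n) < e" using reals_Archimedean[of e] by (auto simp: inverse_eq_divide)
        have "(INF n. S (1 / real (Suc n)) x) \<le> S (1 / real (Suc n)) x" by (intro INF_lower) auto
        also have "\<dots> \<le> S e x" unfolding S_def using n by (intro SUP_subset_mono) auto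
        finally show "(INF n. S (1 / real (Suc n)) x) \<le> S e x" .
      qed
    qed
    finally show ?thesis .
  qed
  then have "grad_mod f = (\<lambda>x. INF n. S (1 / real (Suc n)) x)" by (intro ext)
  then show ?thesis using S by simp
qed

lemma grad_mod_le_lipschitz:
  assumes "L-lipschitz_on UNIV f"
  shows "grad_mod f x \<le> ennreal L"
  unfolding grad_mod_def
proof (rule Limsup_bounded[OF always_eventually], intro allI ennreal_leI)
  fix y
  have "\<bar>f x - f y\<bar> \<le> L * dist x y" using lipschitz_onD[OF assms, of x y] by (simp add: dist_real_def)
  then show "\<bar>f x - f y\<bar> / dist x y \<le> L"
    using lipschitz_on_nonneg[OF assms] by (cases "x = y") (auto simp: field_simps)
qed

text \<open>The set consists of the levels \<open>s\<close> for which \<open>x\<close> lies in the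
  \<open>h n\<close>-neighbourhood of the superlevel set at \<open>s\<close> but not in that set
  itself. With \<open>c\<close> the supremum of the difference quotients over a punctured ball at
  \<open>x\<close>, it fits into an interval of length \<open>c * h n\<close> once
  \<open>h n\<close> is below the radius.\<close>

lemma limsup_slab_quotient_le:
  fixes f :: "'a::metric_space \<Rightarrow> real"
  assumes lip: "L-lipschitz_on UNIV f" and h: "h \<longlonglongrightarrow> 0" "\<And>n. 0 < h n"
  shows "limsup (\<lambda>n. emeasure lborel {s. \<bar>f x\<bar> \<le> s \<and> ennreal s < (SUP y\<in>ball x (h n). ennreal \<bar>f y\<bar>)} / ennreal (h n))
    \<le> grad_mod f x"
  unfolding grad_mod_def Limsup_at
proof (rule INF_greatest)
  fix e :: real assume "e \<in> {0<..}"
  then have e: "0 < e" by simp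
  define S where "S = (SUP y\<in>ball x e - {x}. ennreal (\<bar>f x - f y\<bar> / dist x y))"
  have "S \<le> ennreal L" unfolding S_def
  proof (intro SUP_least ennreal_leI)
    fix y assume "y \<in> ball x e - {x}"
    then show "\<bar>f x - f y\<bar> / dist x y \<le> L"
      using lipschitz_onD[OF lip, of x y] by (auto simp: dist_real_def field_simps)
  qed
  then obtain c where c: "S = ennreal c" "0 \<le> c" by (cases S) (auto simp: top_unique)
  have bound: "\<bar>f y\<bar> \<le> \<bar>f x\<bar> + c * dist x y" if "y \<in> ball x e" for y
  proof (cases "y = x")
    case False
    then have "ennreal (\<bar>f x - f y\<bar> / dist x y) \<le> ennreal c"
      unfolding c(1)[symmetric] S_def using that by (intro SUP_upper) auto
    then have "\<bar>f x - f y\<bar> / dist x y \<le> c" using c(2) by (simp add: ennreal_le_iff)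
    then have "\<bar>f x - f y\<bar> \<le> c * dist x y" using False by (simp add: field_simps)
    then show ?thesis by linarith
  qed simp
  have "eventually (\<lambda>n. h n < e) sequentially" using order_tendstoD(2)[OF h(1) e] .
  then have "eventually (\<lambda>n. emeasure lborel {s. \<bar>f x\<bar> \<le> s \<and> ennreal s < (SUP y\<in>ball x (h n). ennreal \<bar>f y\<bar>)} / ennreal (h n) \<le> S) sequentially"
  proof eventually_elim
    case (elim n)
    have "(SUP y\<in>ball x (h n). ennreal \<bar>f y\<bar>) \<le> ennreal (\<bar>f x\<bar> + c * h n)"
    proof (intro SUP_least ennreal_leI)
      fix y assume y: "y \<in> ball x (h n)"
      then have "\<bar>f y\<bar> \<le> \<bar>f x\<bar> + c * dist x y" using elim by (intro bound) auto
      also have "c * dist x y \<le> c * h n" using y c by (intro mult_left_mono) auto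
      finally show "\<bar>f y\<bar> \<le> \<bar>f x\<bar> + c * h n" by simp
    qed
    then have "s < \<bar>f x\<bar> + c * h n"
      if "\<bar>f x\<bar> \<le> s" "ennreal s < (SUP y\<in>ball x (h n). ennreal \<bar>f y\<bar>)" for s
    proof -
      have "ennreal s < ennreal (\<bar>f x\<bar> + c * h n)"
        using less_le_trans[OF that(2)] \<open>(SUP y\<in>ball x (h n). ennreal \<bar>f y\<bar>) \<le> _\<close> by blast
      then show ?thesis using that(1) by (subst (asm) ennreal_less_iff) auto
    qed
    then have "{s. \<bar>f x\<bar> \<le> s \<and> ennreal s < (SUP y\<in>ball x (h n). ennreal \<bar>f y\<bar>)} \<subseteq> {\<bar>f x\<bar>..<\<bar>f x\<bar> + c * h n}"
      by auto
    then have "emeasure lborel {s. \<bar>f x\<bar> \<le> s \<and> ennreal s < (SUP y\<in>ball x (h n). ennreal \<bar>f y\<bar>)}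
        \<le> emeasure lborel {\<bar>f x\<bar>..<\<bar>f x\<bar> + c * h n}" by (intro emeasure_mono) auto
    also have "\<dots> = ennreal (c * h n)" using c h(2)[of n] by simp
    finally have "emeasure lborel {s. \<bar>f x\<bar> \<le> s \<and> ennreal s < (SUP y\<in>ball x (h n). ennreal \<bar>f y\<bar>)} / ennreal (h n)
        \<le> ennreal (c * h n) / ennreal (h n)" by (rule divide_right_mono_ennreal)
    also have "\<dots> = S" unfolding c(1) using c(2) h(2)[of n] by (simp add: divide_ennreal)
    finally show ?case .
  qed
  then show "limsup (\<lambda>n. emeasure lborel {s. \<bar>f x\<bar> \<le> s \<and> ennreal s < (SUP y\<in>ball x (h n). ennreal \<bar>f y\<bar>)} / ennreal (h n))
      \<le> (SUP y\<in>ball x e - {x}. ennreal (\<bar>f x - f y\<bar> / dist x y))"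
    unfolding S_def by (rule Limsup_bounded)
qed

text \<open>The level set \<open>\<bar>f\<bar> = t1\<close> may have positive measure; integrating over the levels
  \<open>s > r > t1\<close> only keeps it out of the right-hand side.\<close>

lemma coarea_inequality_interior:
  fixes f :: "'a::metric_space \<Rightarrow> real" and M :: "'a measure"
  assumes sets[measurable_cong]: "sets M = sets borel" and lip: "L-lipschitz_on UNIV f"
    and fin: "emeasure M {x. f x \<noteq> 0} < \<infinity>"
    and t: "0 \<le> t1" "t1 < r" "r < t2" and c: "0 \<le> c"
    and per: "\<And>s. r < s \<Longrightarrow> s < t2 \<Longrightarrow> ennreal c \<le> perimeter M {x. s < \<bar>f x\<bar>}"
  shows "ennreal (c * (t2 - r)) \<le> (\<integral>\<^sup>+x\<in>{x. t1 < \<bar>f x\<bar> \<and> \<bar>f x\<bar> < t2}. grad_mod f x \<partial>M)"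
proof -
  have L: "0 \<le> L" using lip by (rule lipschitz_on_nonneg)
  have cont: "continuous_on UNIV f" using lip by (rule lipschitz_on_continuous_on)
  then have [measurable]: "f \<in> borel_measurable borel" by (rule borel_measurable_continuous_onI)
  have [measurable]: "grad_mod f \<in> borel_measurable borel" using cont by (rule borel_measurable_grad_mod)
  have fL: "\<bar>f y\<bar> \<le> \<bar>f x\<bar> + L * dist x y" for x y
    using lipschitz_onD[OF lip, of x y] by (auto simp: dist_real_def)
  define W where "W = {x. f x \<noteq> 0}"
  have [measurable]: "W \<in> sets borel" unfolding W_def by measurable
  \<comment> \<open>Restriction to the set where \<open>f\<close> is nonzero gives a finite measure.
    Exchanging the integrals requires sigma-finiteness, which is not assumed of \<open>M\<close>,
    and the reverse Fatou lemma requires an integrable majorant.\<close>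
  define M' where "M' = density M (indicator W)"
  have sets'[measurable_cong]: "sets M' = sets borel" by (simp add: M'_def sets)
  have space': "space M' = UNIV" "space M = UNIV" using sets_eq_imp_space_eq[OF sets'] sets_eq_imp_space_eq[OF sets] by auto
  have em': "emeasure M' B = emeasure M (W \<inter> B)" if "B \<in> sets borel" for B
    unfolding M'_def using that by (intro emeasure_restricted) (auto simp: sets)
  interpret M': finite_measure M'
    by (rule finite_measureI) (use em'[of UNIV] fin space' in \<open>auto simp: W_def less_top\<close>)
  interpret P: pair_sigma_finite lborel M' ..
  \<comment> \<open>The factor gives \<open>L * h n \<le> r\<close>, so for \<open>s > r\<close> the
    neighbourhood of the superlevel set stays where \<open>f\<close> is nonzero;
    \<open>L + 1\<close> avoids division by 0 when \<open>L = 0\<close>.\<close>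
  define h where "h = (\<lambda>n. r / (L + 1) * (1 / real (Suc n)))"
  have hpos: "0 < h n" for n using L t unfolding h_def by (intro mult_pos_pos divide_pos_pos) auto
  have hle: "L * h n \<le> r" for n
  proof -
    have "h n \<le> r / (L + 1) * 1" unfolding h_def using L t by (intro mult_left_mono) auto
    then have "L * h n \<le> L * (r / (L + 1))" using L by (intro mult_left_mono) auto
    also have "\<dots> \<le> r" using L t by (simp add: field_simps)
    finally show ?thesis .
  qed
  have hlim: "h \<longlonglongrightarrow> 0" unfolding h_def
    using tendsto_mult[OF tendsto_const LIMSEQ_inverse_real_of_nat, of "r / (L + 1)"] by (simp add: inverse_eq_divide)
  define U where "U = (\<lambda>n x. SUP y\<in>ball x (h n). ennreal \<bar>f y\<bar>)"
  have U[measurable]: "U n \<in> borel_measurable borel" for n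
    unfolding U_def by (rule borel_measurable_SUP_ball)
  \<comment> \<open>Integrated in \<open>x\<close>, this kernel is the difference quotient in the
    perimeter of a superlevel set; integrated in \<open>s\<close>, it is the quotient of
    \<open>limsup_slab_quotient_le\<close>, restricted to levels between \<open>r\<close> and
    \<open>t2\<close>.\<close>
  define P where "P = (\<lambda>n s x. if r < s \<and> s < t2 \<and> \<bar>f x\<bar> \<le> s \<and> ennreal s < U n x then 1 / ennreal (h n) else 0)"
  have P[measurable]: "case_prod (P n) \<in> borel_measurable (lborel \<Otimes>\<^sub>M M')" for n
    unfolding P_def by measurable
  have nb: "x \<in> nbhd {x. s < \<bar>f x\<bar>} (h n) \<longleftrightarrow> ennreal s < U n x" if "0 < s" for s x n
    unfolding mem_nbhd_iff U_def using that by (auto simp: less_SUP_iff ennreal_less_iff)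
  have quot: "(emeasure M (nbhd {x. s < \<bar>f x\<bar>} (h n)) - emeasure M {x. s < \<bar>f x\<bar>}) / ennreal (h n)
      = (\<integral>\<^sup>+x. P n s x \<partial>M')" if s: "r < s" "s < t2" for s n
  proof -
    let ?A = "{x. s < \<bar>f x\<bar>}" and ?N = "nbhd {x. s < \<bar>f x\<bar>} (h n)"
    have spos: "0 < s" using s t by simp
    have N: "?N = {x. ennreal s < U n x}" using nb[OF spos] by auto
    have [measurable]: "?N \<in> sets borel" "?A \<in> sets borel" unfolding N by measurable
    have AN: "?A \<subseteq> ?N"
    proof
      fix x assume "x \<in> ?A"
      then show "x \<in> ?N" unfolding mem_nbhd_iff using hpos[of n] by (intro bexI[of _ x]) auto
    qed
    have NW: "?N \<subseteq> W"
    proof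
      fix x assume "x \<in> ?N"
      then obtain y where y: "s < \<bar>f y\<bar>" "dist x y < h n" by (auto simp: mem_nbhd_iff)
      have "L * dist x y \<le> L * h n" using y L by (intro mult_left_mono) auto
      then show "x \<in> W" using y fL[of y x] hle[of n] s by (auto simp: W_def)
    qed
    have "emeasure M ?A \<le> emeasure M W" using AN NW by (intro emeasure_mono) (auto simp: sets)
    then have fA: "emeasure M ?A \<noteq> \<infinity>" using fin by (auto simp: W_def top_unique)
    have "emeasure M ?N - emeasure M ?A = emeasure M (?N - ?A)"
      using fA AN by (intro emeasure_Diff[symmetric]) (auto simp: sets)
    also have "\<dots> = emeasure M' (?N - ?A)"
      using NW by (subst em') (auto intro!: arg_cong[where f = "emeasure M"])
    also have "\<dots> / ennreal (h n) = (\<integral>\<^sup>+x. indicator (?N - ?A) x / ennreal (h n) \<partial>M')"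
      by (subst nn_integral_divide) (auto simp: sets')
    also have "\<dots> = (\<integral>\<^sup>+x. P n s x \<partial>M')"
      using s by (intro nn_integral_cong) (auto simp: P_def nb[OF spos] indicator_def)
    finally show ?thesis .
  qed
  have h0: "filterlim h (at_right 0) sequentially"
    using hlim hpos by (intro filterlim_at_withinI) (auto intro: always_eventually)
  have perP: "ennreal c \<le> liminf (\<lambda>n. \<integral>\<^sup>+x. P n s x \<partial>M')" if s: "r < s" "s < t2" for s
  proof -
    have "ennreal c \<le> liminf (\<lambda>n. (emeasure M (nbhd {x. s < \<bar>f x\<bar>} (h n)) - emeasure M {x. s < \<bar>f x\<bar>}) / ennreal (h n))"
      using per[OF s] unfolding perimeter_def le_Liminf_iff
      by (auto dest: eventually_compose_filterlim[OF _ h0])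
    then show ?thesis unfolding quot[OF s] .
  qed
  have D: "(\<integral>\<^sup>+s. P n s x \<partial>lborel) =
      emeasure lborel {s. r < s \<and> s < t2 \<and> \<bar>f x\<bar> \<le> s \<and> ennreal s < U n x} / ennreal (h n)" for n x
  proof -
    have "(\<integral>\<^sup>+s. P n s x \<partial>lborel) = (\<integral>\<^sup>+s. indicator {s. r < s \<and> s < t2 \<and> \<bar>f x\<bar> \<le> s \<and> ennreal s < U n x} s / ennreal (h n) \<partial>lborel)"
      by (intro nn_integral_cong) (auto simp: P_def)
    also have "\<dots> = emeasure lborel {s. r < s \<and> s < t2 \<and> \<bar>f x\<bar> \<le> s \<and> ennreal s < U n x} / ennreal (h n)"
      by (subst nn_integral_divide) auto
    finally show ?thesis .
  qed
  have Ule: "U n x \<le> ennreal (\<bar>f x\<bar> + L * h n)" for n x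
    unfolding U_def
  proof (intro SUP_least ennreal_leI)
    fix y assume "y \<in> ball x (h n)"
    then have "L * dist x y \<le> L * h n" using L by (intro mult_left_mono) auto
    then show "\<bar>f y\<bar> \<le> \<bar>f x\<bar> + L * h n" using fL[of y x] by simp
  qed
  have sU: "s < \<bar>f x\<bar> + L * h n" if "0 < s" "ennreal s < U n x" for s n x
    using less_le_trans[OF that(2) Ule] that(1) by (simp add: ennreal_less_iff)
  have D_le: "(\<integral>\<^sup>+s. P n s x \<partial>lborel) \<le> ennreal L" for n x
  proof -
    have "emeasure lborel {s. r < s \<and> s < t2 \<and> \<bar>f x\<bar> \<le> s \<and> ennreal s < U n x} \<le> emeasure lborel {\<bar>f x\<bar>..<\<bar>f x\<bar> + L * h n}"
      using sU t by (intro emeasure_mono) auto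
    also have "\<dots> = ennreal (L * h n)" using L hpos[of n] by simp
    finally have "(\<integral>\<^sup>+s. P n s x \<partial>lborel) \<le> ennreal (L * h n) / ennreal (h n)"
      unfolding D by (rule divide_right_mono_ennreal)
    also have "\<dots> = ennreal L" using L hpos[of n] by (simp add: divide_ennreal)
    finally show ?thesis .
  qed
  have D_lim: "limsup (\<lambda>n. \<integral>\<^sup>+s. P n s x \<partial>lborel) \<le> grad_mod f x * indicator {x. t1 < \<bar>f x\<bar> \<and> \<bar>f x\<bar> < t2} x" for x
  proof -
    \<comment> \<open>In the first case the gap between \<open>t1\<close> and \<open>r\<close>
      matters: \<open>\<bar>f x\<bar> + L * h n\<close> eventually drops below \<open>r\<close>, and
      no level remains.\<close>
    consider "\<bar>f x\<bar> \<le> t1" | "t2 \<le> \<bar>f x\<bar>" | "t1 < \<bar>f x\<bar>" "\<bar>f x\<bar> < t2" by linarith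
    then show ?thesis
    proof cases
      case 1
      have "(\<lambda>n. \<bar>f x\<bar> + L * h n) \<longlonglongrightarrow> \<bar>f x\<bar> + L * 0" by (intro tendsto_intros hlim)
      from order_tendstoD(2)[OF this, of r] have "eventually (\<lambda>n. \<bar>f x\<bar> + L * h n < r) sequentially"
        using 1 t by simp
      then have "eventually (\<lambda>n. (\<integral>\<^sup>+s. P n s x \<partial>lborel) \<le> 0) sequentially"
      proof eventually_elim
        case (elim n)
        have "P n s x = 0" for s
        proof -
          have "\<not> (r < s \<and> ennreal s < U n x)" using sU[of s n x] elim t by auto
          then show ?thesis unfolding P_def by auto
        qed
        then show ?case by simp
      qed
      then have "limsup (\<lambda>n. \<integral>\<^sup>+s. P n s x \<partial>lborel) \<le> 0" by (rule Limsup_bounded)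
      then show ?thesis by (rule order_trans) simp
    next
      case 2
      then have "P n s x = 0" for n s unfolding P_def by force
      then show ?thesis by (simp add: Limsup_const)
    next
      case 3
      have "limsup (\<lambda>n. \<integral>\<^sup>+s. P n s x \<partial>lborel)
          \<le> limsup (\<lambda>n. emeasure lborel {s. \<bar>f x\<bar> \<le> s \<and> ennreal s < (SUP y\<in>ball x (h n). ennreal \<bar>f y\<bar>)} / ennreal (h n))"
        unfolding D
      proof (intro Limsup_mono always_eventually allI divide_right_mono_ennreal emeasure_mono)
        fix n
        have "{s. \<bar>f x\<bar> \<le> s \<and> ennreal s < U n x} \<in> sets borel" by measurable
        then show "{s. \<bar>f x\<bar> \<le> s \<and> ennreal s < (SUP y\<in>ball x (h n). ennreal \<bar>f y\<bar>)} \<in> sets lborel"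
          unfolding U_def by simp
      qed (auto simp: U_def)
      also have "\<dots> \<le> grad_mod f x" by (rule limsup_slab_quotient_le[OF lip hlim hpos])
      finally show ?thesis using 3 by simp
    qed
  qed
  have "ennreal (c * (t2 - r)) = (\<integral>\<^sup>+s. ennreal c * indicator {r<..<t2} s \<partial>lborel)"
    using c t by (simp add: nn_integral_cmult_indicator ennreal_mult)
  also have "\<dots> \<le> (\<integral>\<^sup>+s. liminf (\<lambda>n. \<integral>\<^sup>+x. P n s x \<partial>M') \<partial>lborel)"
    using perP by (intro nn_integral_mono) (auto simp: indicator_def)
  also have "\<dots> \<le> liminf (\<lambda>n. \<integral>\<^sup>+s. (\<integral>\<^sup>+x. P n s x \<partial>M') \<partial>lborel)"
  proof (rule nn_integral_liminf)
    show "(\<lambda>s. \<integral>\<^sup>+x. P n s x \<partial>M') \<in> borel_measurable lborel" for n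
      using M'.borel_measurable_nn_integral[OF P[of n]] .
  qed
  also have "\<dots> = liminf (\<lambda>n. \<integral>\<^sup>+x. (\<integral>\<^sup>+s. P n s x \<partial>lborel) \<partial>M')"
    by (subst P.Fubini'[OF P]) simp
  also have "\<dots> \<le> limsup (\<lambda>n. \<integral>\<^sup>+x. (\<integral>\<^sup>+s. P n s x \<partial>lborel) \<partial>M')"
    by (intro Liminf_le_Limsup) simp
  also have "\<dots> \<le> (\<integral>\<^sup>+x. limsup (\<lambda>n. \<integral>\<^sup>+s. P n s x \<partial>lborel) \<partial>M')"
  \<comment> \<open>The reverse Fatou lemma: the kernels integrate in \<open>s\<close> to at most
    \<open>L\<close>, and a constant is integrable for the finite measure \<open>M'\<close>.\<close>
  proof (rule nn_integral_limsup[where w = "\<lambda>_. ennreal L"])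
    show "(\<lambda>x. \<integral>\<^sup>+s. P n s x \<partial>lborel) \<in> borel_measurable M'" for n
    proof -
      have "(\<lambda>(x, s). P n s x) \<in> borel_measurable (M' \<Otimes>\<^sub>M lborel)"
        using measurable_pair_swap[OF P[of n]] by (simp add: case_prod_unfold)
      from lborel.borel_measurable_nn_integral[OF this] show ?thesis .
    qed
  qed (use D_le M'.emeasure_finite[of UNIV] in \<open>auto simp: space' ennreal_mult_eq_top_iff less_top[symmetric]\<close>)
  also have "\<dots> \<le> (\<integral>\<^sup>+x. grad_mod f x * indicator {x. t1 < \<bar>f x\<bar> \<and> \<bar>f x\<bar> < t2} x \<partial>M')"
    by (intro nn_integral_mono D_lim)
  also have "\<dots> = (\<integral>\<^sup>+x. indicator W x * (grad_mod f x * indicator {x. t1 < \<bar>f x\<bar> \<and> \<bar>f x\<bar> < t2} x) \<partial>M)"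
    unfolding M'_def by (subst nn_integral_density) auto
  also have "\<dots> \<le> (\<integral>\<^sup>+x\<in>{x. t1 < \<bar>f x\<bar> \<and> \<bar>f x\<bar> < t2}. grad_mod f x \<partial>M)"
    by (intro nn_integral_mono) (auto simp: indicator_def)
  finally show ?thesis .
qed

lemma coarea_inequality:
  fixes f :: "'a::metric_space \<Rightarrow> real" and M :: "'a measure"
  assumes "sets M = sets borel" "L-lipschitz_on UNIV f" "emeasure M {x. f x \<noteq> 0} < \<infinity>"
    and t: "0 \<le> t1" "t1 \<le> t2" and c: "0 \<le> c"
    and per: "\<And>s. t1 < s \<Longrightarrow> s < t2 \<Longrightarrow> ennreal c \<le> perimeter M {x. s < \<bar>f x\<bar>}"
  shows "ennreal (c * (t2 - t1)) \<le> (\<integral>\<^sup>+x\<in>{x. t1 < \<bar>f x\<bar> \<and> \<bar>f x\<bar> < t2}. grad_mod f x \<partial>M)"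
proof (cases "t1 = t2")
  case False
  \<comment> \<open>The lower levels decrease to \<open>t1\<close>; the summand 2 keeps
    \<open>r 0\<close> strictly below \<open>t2\<close>.\<close>
  define r where "r = (\<lambda>n. t1 + (t2 - t1) / real (n + 2))"
  have r: "t1 < r n" "r n < t2" for n
  proof -
    have "(t2 - t1) / real (n + 2) < (t2 - t1) / 1" using t False by (intro divide_strict_left_mono) auto
    then show "t1 < r n" "r n < t2" using t False unfolding r_def by auto
  qed
  have "r \<longlonglongrightarrow> t1 + 0" unfolding r_def
    by (intro tendsto_add tendsto_const LIMSEQ_ignore_initial_segment[where f = "\<lambda>n. (t2 - t1) / real n"] lim_const_over_n)
  then have "(\<lambda>n. ennreal (c * (t2 - r n))) \<longlonglongrightarrow> ennreal (c * (t2 - t1))"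
    by (intro tendsto_intros) simp
  then show ?thesis
  proof (rule tendsto_upperbound)
    show "eventually (\<lambda>n. ennreal (c * (t2 - r n)) \<le> (\<integral>\<^sup>+x\<in>{x. t1 < \<bar>f x\<bar> \<and> \<bar>f x\<bar> < t2}. grad_mod f x \<partial>M)) sequentially"
      using r per by (intro always_eventually allI coarea_inequality_interior[OF assms(1-4) r c]) (meson less_trans)
  qed simp
qed simp

subsection \<open>Symmetrization of compactly supported Lipschitz functions\<close>

lemma ennreal_enn2real_of_le: "a \<le> ennreal b \<Longrightarrow> ennreal (enn2real a) = a"
  by (cases a) (auto simp: top_unique)

lemma profile_le_perimeter:
  assumes "A \<in> sets M" "emeasure M A = ennreal t"
  shows "ennreal (iso_profile M t) \<le> perimeter M A"
proof -
  have "iso_inf M t \<le> perimeter M A" unfolding iso_inf_def using assms by (intro INF_lower) simp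
  then show ?thesis unfolding iso_profile_def by (cases "iso_inf M t") (auto simp: top_unique)
qed

lemma Lip0_bounded:
  assumes "f \<in> Lip0" shows "\<exists>B\<ge>0. \<forall>x. \<bar>f x\<bar> \<le> B"
proof -
  obtain L where L: "L-lipschitz_on UNIV f" and K: "compact (closure {x. f x \<noteq> 0})"
    using assms by (auto simp: Lip0_def)
  have "continuous_on (closure {x. f x \<noteq> 0}) f"
    using lipschitz_on_continuous_on[OF L] by (rule continuous_on_subset) simp
  then have "bounded (f ` closure {x. f x \<noteq> 0})" using K by (intro compact_imp_bounded compact_continuous_image)
  then obtain B where B: "\<And>x. x \<in> closure {x. f x \<noteq> 0} \<Longrightarrow> \<bar>f x\<bar> \<le> B" by (auto simp: bounded_iff)
  have "\<bar>f x\<bar> \<le> max B 0" for x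
  proof (cases "f x = 0")
    case False
    then have "x \<in> closure {x. f x \<noteq> 0}" using closure_subset[of "{x. f x \<noteq> 0}"] by blast
    from B[OF this] show ?thesis by simp
  qed simp
  then show ?thesis by (intro exI[of _ "max B 0"]) auto
qed

locale isoperimetric_lip =
  fixes M :: "'a::metric_space measure" and f :: "'a \<Rightarrow> real"
  assumes iso: "isoperimetric_space M" and f: "f \<in> Lip0"
begin

abbreviation I :: "real \<Rightarrow> real" where "I \<equiv> iso_profile M"

definition w :: "real \<Rightarrow> real" where "w s = enn2real (rearr M (absf f) s)"

lemma sets_M [measurable_cong, simp]: "sets M = sets borel"
  using iso by (simp add: isoperimetric_space_def)

lemma space_M [simp]: "space M = UNIV"
  using sets_eq_imp_space_eq[OF sets_M] by simp

lemma I_pos: "0 < t \<Longrightarrow> 0 < I t" and I_0: "I 0 = 0"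
  and I_mono: "0 \<le> s \<Longrightarrow> s \<le> t \<Longrightarrow> I s \<le> I t"
  using iso unfolding isoperimetric_space_def mono_on_def by auto

lemma I_nonneg: "0 \<le> t \<Longrightarrow> 0 \<le> I t"
  using I_pos[of t] I_0 by (cases "t = 0") auto

text \<open>Concavity and \<open>I 0 = 0\<close> make \<open>I t / t\<close> decreasing; this is the
  comparison at neighbouring nodes.\<close>

lemma I_ratio: "0 < d \<Longrightarrow> real k / real (Suc k) * I (real (Suc k) * d) \<le> I (real k * d)"
proof -
  assume d: "0 < d"
  have conc: "concave_on {0..} I" using iso by (simp add: isoperimetric_space_def)
  have "(1 - real k / real (Suc k)) * I 0 + real k / real (Suc k) * I (real (Suc k) * d)
      \<le> I ((1 - real k / real (Suc k)) *\<^sub>R 0 + (real k / real (Suc k)) *\<^sub>R (real (Suc k) * d))"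
    using d by (intro concave_onD[OF conc]) auto
  also have "(1 - real k / real (Suc k)) *\<^sub>R 0 + (real k / real (Suc k)) *\<^sub>R (real (Suc k) * d) = real k * d"
    by simp
  finally show ?thesis by (simp add: I_0)
qed

lemma ex_lipschitz: "\<exists>L. L-lipschitz_on UNIV f" using f by (simp add: Lip0_def)

lemma continuous_f: "continuous_on UNIV f" using ex_lipschitz lipschitz_on_continuous_on by blast

lemma measurable_f [measurable]: "f \<in> borel_measurable borel"
  using continuous_f by (rule borel_measurable_continuous_onI)

lemma measurable_grad [measurable]: "grad_mod f \<in> borel_measurable borel"
  using continuous_f by (rule borel_measurable_grad_mod)

lemma ex_grad_bound: "\<exists>L\<ge>0. \<forall>x. grad_mod f x \<le> ennreal L"
  using ex_lipschitz grad_mod_le_lipschitz lipschitz_on_nonneg by blast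

lemma ex_support_measure: "\<exists>V\<ge>0. emeasure M {x. f x \<noteq> 0} \<le> ennreal V"
proof -
  have "emeasure M (closure {x. f x \<noteq> 0}) < \<infinity>"
    using iso f by (simp add: isoperimetric_space_def Lip0_def)
  moreover have "emeasure M {x. f x \<noteq> 0} \<le> emeasure M (closure {x. f x \<noteq> 0})"
    by (intro emeasure_mono closure_subset) auto
  ultimately have "emeasure M {x. f x \<noteq> 0} < \<infinity>" by (auto intro: le_less_trans)
  then show ?thesis by (intro exI[of _ "enn2real (emeasure M {x. f x \<noteq> 0})"]) (simp add: less_top)
qed

lemma support_finite: "emeasure M {x. f x \<noteq> 0} < \<infinity>"
  using ex_support_measure by (auto intro: le_less_trans)

lemma distribution_f: "0 \<le> t \<Longrightarrow> distribution M (absf f) (ennreal t) = emeasure M {x. t < \<bar>f x\<bar>}"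
  unfolding distribution_def by (auto simp: absf_def ennreal_less_iff)

lemma rearr_f: "rearr M (absf f) s = ennreal (w s)"
proof -
  obtain B where "\<forall>x. \<bar>f x\<bar> \<le> B" using Lip0_bounded[OF f] by auto
  then have "rearr M (absf f) s \<le> ennreal B" by (intro rearr_le_bound) (auto simp: absf_def ennreal_leI)
  then show ?thesis unfolding w_def by (simp add: ennreal_enn2real_of_le)
qed

lemma w_nonneg: "0 \<le> w s" by (simp add: w_def)

lemma w_antimono: "s \<le> t \<Longrightarrow> w t \<le> w s"
  using rearr_antimono[of s t M "absf f"] w_nonneg by (simp add: rearr_f)

lemma measurable_w [measurable]: "w \<in> borel_measurable borel"
  unfolding w_def[abs_def] by (rule borel_measurable_rearr) (simp add: rearr_f)

lemma emeasure_above_w: "emeasure M {x. w s < \<bar>f x\<bar>} \<le> ennreal s"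
proof -
  have "distribution M (absf f) (rearr M (absf f) s) \<le> ennreal s"
    by (rule distribution_rearr_le) measurable
  then show ?thesis by (simp add: rearr_f distribution_f w_nonneg)
qed

lemma emeasure_below_w:
  assumes "0 \<le> t" "t < w s" shows "ennreal s < emeasure M {x. t < \<bar>f x\<bar>}"
  using less_rearrD[of "ennreal t" M "absf f" s] assms
  by (simp add: rearr_f ennreal_less_iff distribution_f)

lemma emeasure_superlevel_finite: "0 \<le> t \<Longrightarrow> emeasure M {x. t < \<bar>f x\<bar>} < \<infinity>"
  by (rule le_less_trans[OF emeasure_mono support_finite]) auto

lemma w_eq_0: "emeasure M {x. f x \<noteq> 0} \<le> ennreal s \<Longrightarrow> w s = 0"
proof -
  assume *: "emeasure M {x. f x \<noteq> 0} \<le> ennreal s"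
  have "{x. 0 < \<bar>f x\<bar>} = {x. f x \<noteq> 0}" by auto
  with * have "distribution M (absf f) (ennreal 0) \<le> ennreal s" by (subst distribution_f) simp_all
  then have "rearr M (absf f) s \<le> ennreal 0" by (rule rearr_leI)
  then show ?thesis using w_nonneg[of s] by (simp add: rearr_f)
qed

section \<open>Slabs between two values of the rearrangement\<close>

text \<open>For a level strictly between the two values the superlevel set has measure above
  \<open>s1\<close>, so monotonicity of the profile bounds its perimeter below by
  \<open>I s1\<close>. This is the one place where a perimeter meets the profile.\<close>

lemma polya_szego_slab:
  assumes "0 \<le> s1" "s1 \<le> s2"
  shows "ennreal (I s1 * (w s1 - w s2)) \<le> (\<integral>\<^sup>+x\<in>{x. w s2 < \<bar>f x\<bar> \<and> \<bar>f x\<bar> < w s1}. grad_mod f x \<partial>M)"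
proof -
  obtain L where L: "L-lipschitz_on UNIV f" using ex_lipschitz by auto
  show ?thesis
  proof (rule coarea_inequality[OF sets_M L support_finite w_nonneg w_antimono[OF assms(2)] I_nonneg[OF assms(1)]])
    fix s assume s: "w s2 < s" "s < w s1"
    then have s0: "0 \<le> s" using w_nonneg[of s2] by linarith
    define m where "m = measure M {x. s < \<bar>f x\<bar>}"
    have m: "emeasure M {x. s < \<bar>f x\<bar>} = ennreal m"
      unfolding m_def using emeasure_superlevel_finite[OF s0] by (intro emeasure_eq_ennreal_measure) auto
    have "s1 < m" using emeasure_below_w[OF s0 s(2)] assms(1) by (simp add: m ennreal_less_iff)
    then have "ennreal (I s1) \<le> ennreal (I m)" using assms(1) by (intro ennreal_leI I_mono) auto
    also have "\<dots> \<le> perimeter M {x. s < \<bar>f x\<bar>}" by (intro profile_le_perimeter m) auto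
    finally show "ennreal (I s1) \<le> perimeter M {x. s < \<bar>f x\<bar>}" .
  qed
qed

text \<open>\<open>\<bar>f\<bar> \<ge> w s1\<close> holds on measure at least \<open>s1\<close>,
  \<open>\<bar>f\<bar> > w s2\<close> on measure at most \<open>s2\<close>, and the slab is the
  difference of the two sets. Leaving out the level \<open>w s1\<close>, which may carry mass, is
  essential.\<close>

lemma emeasure_slab:
  assumes "0 \<le> s1" "s1 \<le> s2"
  shows "emeasure M {x. w s2 < \<bar>f x\<bar> \<and> \<bar>f x\<bar> < w s1} \<le> ennreal (s2 - s1)"
proof (cases "w s2 < w s1")
  case False
  then have "{x. w s2 < \<bar>f x\<bar> \<and> \<bar>f x\<bar> < w s1} = {}" by auto
  then show ?thesis by (simp only: emeasure_empty) simp
next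
  case True
  then have pos: "0 < w s1" using w_nonneg[of s2] by linarith
  \<comment> \<open>Levels increasing to \<open>w s1\<close>, starting at 0; being nonnegative, they
    give sets of finite measure, as continuity along decreasing sets requires.\<close>
  define A where "A = (\<lambda>n. {x. w s1 - w s1 / real (Suc n) < \<bar>f x\<bar>})"
  have A0: "0 \<le> w s1 - w s1 / real (Suc n)" "w s1 - w s1 / real (Suc n) < w s1" for n
    using pos by (auto simp: field_simps)
  have "(INF n. emeasure M (A n)) = emeasure M (\<Inter>n. A n)"
  proof (rule INF_emeasure_decseq)
    show "range A \<subseteq> sets M" unfolding A_def by auto
    show "decseq A"
    proof (rule decseq_SucI)
      fix n
      have "w s1 / real (Suc (Suc n)) \<le> w s1 / real (Suc n)" using pos by (intro divide_left_mono) auto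
      then show "A (Suc n) \<subseteq> A n" unfolding A_def by auto
    qed
    show "emeasure M (A n) \<noteq> \<infinity>" for n
      unfolding A_def using emeasure_superlevel_finite[OF A0(1)] by (simp add: less_top)
  qed
  moreover have "(\<Inter>n. A n) = {x. w s1 \<le> \<bar>f x\<bar>}"
  proof (intro set_eqI iffI)
    fix x assume x: "x \<in> (\<Inter>n. A n)"
    have "(\<lambda>n. w s1 - w s1 / real (Suc n)) \<longlonglongrightarrow> w s1 - 0"
      by (intro tendsto_diff tendsto_const LIMSEQ_Suc[OF lim_const_over_n])
    moreover have "w s1 - w s1 / real (Suc n) \<le> \<bar>f x\<bar>" for n using x by (auto simp: A_def less_imp_le)
    ultimately have "w s1 - 0 \<le> \<bar>f x\<bar>" by (intro LIMSEQ_le_const2) auto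
    then show "x \<in> {x. w s1 \<le> \<bar>f x\<bar>}" by simp
  next
    fix x assume "x \<in> {x. w s1 \<le> \<bar>f x\<bar>}"
    then have "w s1 - w s1 / real (Suc n) < \<bar>f x\<bar>" for n using A0(2)[of n] by simp
    then show "x \<in> (\<Inter>n. A n)" unfolding A_def by blast
  qed
  moreover have "ennreal s1 \<le> (INF n. emeasure M (A n))"
    unfolding A_def using emeasure_below_w[OF A0] by (intro INF_greatest less_imp_le)
  ultimately have ge: "ennreal s1 \<le> emeasure M {x. w s1 \<le> \<bar>f x\<bar>}" by simp
  have "ennreal s1 + emeasure M {x. w s2 < \<bar>f x\<bar> \<and> \<bar>f x\<bar> < w s1}
      \<le> emeasure M {x. w s1 \<le> \<bar>f x\<bar>} + emeasure M {x. w s2 < \<bar>f x\<bar> \<and> \<bar>f x\<bar> < w s1}"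
    using ge by (rule add_right_mono)
  also have "\<dots> = emeasure M ({x. w s1 \<le> \<bar>f x\<bar>} \<union> {x. w s2 < \<bar>f x\<bar> \<and> \<bar>f x\<bar> < w s1})"
    by (rule plus_emeasure) auto
  also have "{x. w s1 \<le> \<bar>f x\<bar>} \<union> {x. w s2 < \<bar>f x\<bar> \<and> \<bar>f x\<bar> < w s1} = {x. w s2 < \<bar>f x\<bar>}"
    using True by auto
  also have "emeasure M {x. w s2 < \<bar>f x\<bar>} \<le> ennreal s2" by (rule emeasure_above_w)
  also have "ennreal s2 = ennreal s1 + ennreal (s2 - s1)"
    using assms by (subst ennreal_plus[symmetric]) auto
  finally show ?thesis by (simp add: ennreal_add_left_cancel_le)
qed

text \<open>The profile is taken at the left end of the cell, which is what
  \<open>polya_szego_slab\<close> provides; since \<open>I 0 = 0\<close>, the first slope is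
  0.\<close>

definition slope :: "real \<Rightarrow> nat \<Rightarrow> real" where
  "slope d k = I (real k * d) * (w (real k * d) - w (real (Suc k) * d)) / d"

lemma slope_nonneg: "0 < d \<Longrightarrow> 0 \<le> slope d k"
proof -
  assume d: "0 < d"
  then have "real k * d \<le> real (Suc k) * d" by (intro mult_right_mono) auto
  then show ?thesis unfolding slope_def using d I_nonneg[of "real k * d"] w_antimono
    by (intro divide_nonneg_pos mult_nonneg_nonneg) auto
qed

text \<open>A discrete form of the Polya--Szego principle: \<open>slope\<close> discretizes \<open>- I (f\<^sup>*)'\<close>, so that no
  absolute continuity of the rearrangement is needed.\<close>

lemma slope_sum_le:
  assumes res: "resonant M" and d: "0 < d" and K: "finite K"
  shows "ennreal (d * sum (slope d) K) \<le> (\<integral>\<^sup>+s\<in>{0<..real (card K) * d}. rearr M (grad_mod f) s \<partial>lborel)"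
proof -
  \<comment> \<open>Both inequalities are strict, so slabs of different cells are disjoint.\<close>
  define E where "E = (\<lambda>k. {x. w (real (Suc k) * d) < \<bar>f x\<bar> \<and> \<bar>f x\<bar> < w (real k * d)})"
  have E[measurable]: "E k \<in> sets borel" for k unfolding E_def by measurable
  have kd: "0 \<le> real k * d" "real k * d \<le> real (Suc k) * d" for k
    using d by (auto intro: mult_right_mono)
  have disj: "disjoint_family_on E K"
  proof -
    have *: "E j \<inter> E k = {}" if "j < k" for j k
    proof -
      have "real (Suc j) * d \<le> real k * d" using that d by (intro mult_right_mono) auto
      then have "w (real k * d) \<le> w (real (Suc j) * d)" by (rule w_antimono)
      then show ?thesis unfolding E_def by auto
    qed
    then show ?thesis unfolding disjoint_family_on_def by (metis inf_commute nat_neq_iff)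
  qed
  \<comment> \<open>Resonance speaks of real functions; the gradient is finite because
    \<open>f\<close> is Lipschitz.\<close>
  define G where "G = (\<lambda>x. enn2real (grad_mod f x))"
  have [measurable]: "G \<in> borel_measurable borel" unfolding G_def by measurable
  have G: "absf G = grad_mod f"
  proof
    fix x
    obtain L where "\<forall>x. grad_mod f x \<le> ennreal L" using ex_grad_bound by auto
    then have "grad_mod f x < \<infinity>" by (metis ennreal_less_top infinity_ennreal_def le_less_trans)
    then show "absf G x = grad_mod f x" by (simp add: absf_def G_def)
  qed
  have "ennreal (d * sum (slope d) K) = (\<Sum>k\<in>K. ennreal (I (real k * d) * (w (real k * d) - w (real (Suc k) * d))))"
  proof -
    have "d * sum (slope d) K = (\<Sum>k\<in>K. I (real k * d) * (w (real k * d) - w (real (Suc k) * d)))"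
      unfolding slope_def sum_distrib_left using d by (intro sum.cong) auto
    moreover have "0 \<le> I (real k * d) * (w (real k * d) - w (real (Suc k) * d))" for k
      using kd[of k] w_antimono I_nonneg by (intro mult_nonneg_nonneg) auto
    ultimately show ?thesis by (simp add: sum_ennreal)
  qed
  also have "\<dots> \<le> (\<Sum>k\<in>K. \<integral>\<^sup>+x\<in>E k. grad_mod f x \<partial>M)"
    unfolding E_def using kd by (intro sum_mono polya_szego_slab)
  also have "\<dots> = (\<integral>\<^sup>+x. (\<Sum>k\<in>K. grad_mod f x * indicator (E k) x) \<partial>M)"
    by (subst nn_integral_sum) auto
  also have "\<dots> = (\<integral>\<^sup>+x\<in>(\<Union>k\<in>K. E k). absf G x \<partial>M)"
    unfolding indicator_UN_disjoint[OF K disj] sum_distrib_left G ..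
  also have "\<dots> \<le> (\<integral>\<^sup>+s\<in>{0<..real (card K) * d}. rearr M (absf G) s \<partial>lborel)"
  proof (rule resonant_set_integral_le[OF res])
    have "emeasure M (\<Union>k\<in>K. E k) \<le> (\<Sum>k\<in>K. emeasure M (E k))"
      using K by (intro emeasure_subadditive_finite) auto
    also have "\<dots> \<le> (\<Sum>k\<in>K. ennreal d)"
    proof (rule sum_mono)
      fix k
      show "emeasure M (E k) \<le> ennreal d"
        using emeasure_slab[OF kd, of k] by (simp add: E_def algebra_simps)
    qed
    also have "\<dots> = ennreal (real (card K) * d)" using d by (simp add: ennreal_mult ennreal_of_nat_eq_real_of_nat)
    finally show "emeasure M (\<Union>k\<in>K. E k) \<le> ennreal (real (card K) * d)" .
  qed (use K in auto)
  finally show ?thesis by (simp add: G)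
qed

lemma rearr_grad: "rearr M (grad_mod f) s = ennreal (enn2real (rearr M (grad_mod f) s))"
proof -
  obtain L where "\<forall>x. grad_mod f x \<le> ennreal L" using ex_grad_bound by auto
  then have "rearr M (grad_mod f) s \<le> ennreal L" by (intro rearr_le_bound) auto
  then show ?thesis by (simp add: ennreal_enn2real_of_le)
qed

text \<open>The slopes need not decrease in \<open>k\<close>, which is why
  \<open>slope_sum_le\<close> treats arbitrary finite index sets. A Lipschitz constant of
  \<open>f\<close> supplies the bound on the majorant that \<open>step_norm_le\<close> asks
  for.\<close>

lemma polya_szego_norm:
  assumes "resonant M" "represents M \<sigma> \<rho>" and d: "0 < d"
  shows "\<sigma> (\<lambda>x. ennreal (step d N (slope d) x)) \<le> \<rho> (grad_mod f)"
proof -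
  define q where "q = (\<lambda>s. enn2real (rearr M (grad_mod f) s))"
  have q: "rearr M (grad_mod f) s = ennreal (q s)" for s unfolding q_def by (rule rearr_grad)
  have q_nonneg: "0 \<le> q s" for s by (simp add: q_def)
  obtain L where L: "\<forall>x. grad_mod f x \<le> ennreal L" "0 \<le> L" using ex_grad_bound by auto
  have "\<sigma> (\<lambda>x. ennreal (step d N (slope d) x)) \<le> \<sigma> (\<lambda>x. ennreal (q x))"
  proof (rule step_norm_le[OF _ d])
    show "ri_norm lebesgue_pos \<sigma>" using assms(2) by (simp add: represents_def)
    show "antimono_on {0<..} q"
    proof (rule monotone_onI)
      fix x y :: real assume "x \<le> y"
      from rearr_antimono[OF this, of M "grad_mod f"] show "q y \<le> q x" using q_nonneg by (simp add: q)
    qed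
    have "rearr M (grad_mod f) x \<le> ennreal L" for x
      using L by (intro rearr_le_bound) auto
    then show "q x \<le> L" for x using L(2) by (simp add: q)
    show "q \<in> borel_measurable borel" unfolding q_def by (rule borel_measurable_rearr) (simp add: q)
    fix K assume "K \<subseteq> {..<N}"
    then have "finite K" by (rule finite_subset) simp
    from slope_sum_le[OF assms(1) d this]
    show "ennreal (d * sum (slope d) K) \<le> (\<integral>\<^sup>+x\<in>{0<..real (card K) * d}. ennreal (q x) \<partial>lborel)" by (simp add: q)
  qed (auto simp: q_def slope_nonneg[OF d])
  also have "(\<lambda>x. ennreal (q x)) = rearr M (grad_mod f)" using q by auto
  also have "\<sigma> (rearr M (grad_mod f)) = \<rho> (grad_mod f)"
  proof -
    have "AE x in M. grad_mod f x < \<infinity>"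
      using L by (intro AE_I2) (metis ennreal_less_top infinity_ennreal_def le_less_trans)
    then show ?thesis using assms(2) unfolding represents_def by simp
  qed
  finally show ?thesis .
qed

end

subsection \<open>The isoperimetric Hardy operator\<close>

text \<open>Homogeneity reduces the claim to functions of norm 1, which compete in the
  supremum.\<close>

lemma op_norm_bound:
  assumes bfn: "banach_function_norm lebesgue_pos \<sigma>" and bdd: "iso_hardy_bounded I \<sigma>"
    and h: "h \<in> fspace lebesgue_pos \<sigma>"
  shows "\<sigma> (absf (iso_hardy I h)) \<le> op_norm \<sigma> (iso_hardy I) * \<sigma> (absf h)"
proof (cases "\<sigma> (absf h) = 0")
  \<comment> \<open>A function of norm 0 cannot be normalized; the constant in
    \<open>iso_hardy_bounded\<close> shows that its image has norm 0.\<close>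
  case True
  then show ?thesis using bdd h unfolding iso_hardy_bounded_def by force
next
  case False
  have hm: "h \<in> borel_measurable lebesgue_pos" and fin: "\<sigma> (absf h) < \<infinity>" using h by (auto simp: fspace_def)
  define c where "c = enn2real (\<sigma> (absf h))"
  have c: "\<sigma> (absf h) = ennreal c" "0 < c"
    using False fin unfolding c_def by (auto simp: enn2real_positive_iff less_top zero_less_iff_neq_zero)
  define h' where "h' = (\<lambda>x. 1 / c * h x)"
  have absf_scale: "absf (\<lambda>x. 1 / c * u x) = (\<lambda>x. ennreal (1 / c) * absf u x)" for u :: "real \<Rightarrow> real"
    unfolding absf_def fun_eq_iff using c(2) by (auto simp: abs_mult ennreal_mult[symmetric])
  have h'm: "h' \<in> borel_measurable lebesgue_pos" unfolding h'_def using hm by measurable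
  have "\<sigma> (absf h') = ennreal (1 / c) * \<sigma> (absf h)"
    unfolding h'_def absf_scale using c hm by (intro bfn_scale[OF bfn]) auto
  also have "\<dots> = 1" using c by (simp add: ennreal_mult[symmetric])
  finally have h'1: "\<sigma> (absf h') = 1" .
  then have h'f: "h' \<in> fspace lebesgue_pos \<sigma>" using h'm by (simp add: fspace_def)
  have "iso_hardy I h' = (\<lambda>t. 1 / c * iso_hardy I h t)"
  proof
    fix t
    have "(LINT s:{t<..}|lborel. h' s / I s) = (LINT s:{t<..}|lborel. 1 / c * (h s / I s))"
      by (simp add: h'_def)
    also have "\<dots> = 1 / c * (LINT s:{t<..}|lborel. h s / I s)" by (rule set_integral_mult_right)
    finally show "iso_hardy I h' t = 1 / c * iso_hardy I h t"
      unfolding iso_hardy_def by simp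
  qed
  then have "ennreal (1 / c) * \<sigma> (absf (iso_hardy I h)) = \<sigma> (absf (iso_hardy I h'))"
    using bdd h c unfolding iso_hardy_bounded_def
    by (simp only: absf_scale, subst bfn_scale[OF bfn]) (auto simp: fspace_def)
  also have "\<dots> \<le> op_norm \<sigma> (iso_hardy I)"
    unfolding op_norm_def using h'f h'1 by (intro SUP_upper) auto
  finally have "ennreal c * (ennreal (1 / c) * \<sigma> (absf (iso_hardy I h))) \<le> ennreal c * op_norm \<sigma> (iso_hardy I)"
    by (rule mult_left_mono) simp
  moreover have "ennreal c * ennreal (1 / c) = 1" using c(2) by (simp add: ennreal_mult[symmetric])
  ultimately show ?thesis unfolding c(1) mult.assoc[symmetric] by (simp add: mult.commute)
qed

section \<open>Recovering the rearrangement from its slopes\<close>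

context isoperimetric_lip
begin

text \<open>On a cell with index \<open>k \<ge> j\<close> the integrand is at least
  \<open>slope d k / I (real (Suc k) * d)\<close>. Times \<open>d\<close> this is the drop of
  \<open>w\<close> across the cell times a quotient of profile values that is at least
  \<open>k / (k + 1)\<close>. The drops telescope up to \<open>real N * d\<close>, where
  \<open>w\<close> vanishes.\<close>

lemma iso_hardy_step_ge:
  assumes d: "0 < d" and t: "0 < t" and N: "emeasure M {x. f x \<noteq> 0} \<le> ennreal (real N * d)"
    and int: "set_integrable lborel {t<..} (\<lambda>s. step d N (slope d) s / I s)"
  shows "I t / t * ((1 - d / t) * w (t + d)) \<le> iso_hardy I (step d N (slope d)) t"
proof -
  \<comment> \<open>The first node not below \<open>t\<close>: all cells from there on lie in
    \<open>{t<..}\<close>, and the node is less than \<open>t + d\<close>.\<close>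
  define j where "j = nat \<lceil>t / d\<rceil>"
  have "0 < t / d" using t d by simp
  then have j: "t / d \<le> real j" "real j < t / d + 1" unfolding j_def by linarith+
  have jt: "t \<le> real j * d" "real j * d < t + d" using j d by (auto simp: field_simps)
  \<comment> \<open>A lower bound for the integrand on the cell: \<open>I\<close> is increasing, so
    its right-end value is the largest. Cells before \<open>j\<close> are given up.\<close>
  define b where "b = (\<lambda>k. if j \<le> k then slope d k / I (real (Suc k) * d) else 0)"
  have Ipos: "0 < I (real (Suc k) * d)" for k using d by (intro I_pos) simp
  have b: "\<forall>k<N. 0 \<le> b k"
    using slope_nonneg[OF d] Ipos by (auto simp: b_def intro!: divide_nonneg_pos)
  define l where "l = (LINT s:{t<..}|lborel. step d N (slope d) s / I s)"
  have step0: "0 \<le> step d N (slope d) s" for s using slope_nonneg[OF d] by (intro step_nonneg) auto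
  have pos: "0 \<le> indicator {t<..} s * (step d N (slope d) s / I s)" for s
    using step0[of s] I_pos[of s] t by (auto simp: indicator_def intro!: divide_nonneg_pos)
  have l0: "0 \<le> l" unfolding l_def set_lebesgue_integral_def
    using pos by (intro integral_nonneg_AE) auto
  have "ennreal (d * sum b {..<N}) = (\<integral>\<^sup>+s. ennreal (step d N b s) \<partial>lborel)"
    by (rule nn_integral_step[OF d b, symmetric])
  also have "\<dots> \<le> (\<integral>\<^sup>+s. ennreal (indicator {t<..} s * (step d N (slope d) s / I s)) \<partial>lborel)"
  proof (intro nn_integral_mono ennreal_leI)
    fix s :: real
    show "step d N b s \<le> indicator {t<..} s * (step d N (slope d) s / I s)"
    proof (cases "0 < s")
      case True
      then obtain k where k: "s \<in> cell d k" using cell_cover[OF d] by auto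
      then have s: "real k * d < s" "s \<le> real (Suc k) * d" by (auto simp: cell_def)
      show ?thesis
      proof (cases "k < N \<and> j \<le> k")
        case kj: True
        then have "real j * d \<le> real k * d" using d by (intro mult_right_mono) auto
        then have "t < s" using s jt by linarith
        moreover have "slope d k / I (real (Suc k) * d) \<le> slope d k / I s"
          using I_mono[of s "real (Suc k) * d"] s(2) True I_pos[OF True] slope_nonneg[OF d]
          by (intro divide_left_mono mult_pos_pos Ipos) auto
        ultimately show ?thesis unfolding step_cell[OF d k] using kj by (simp add: b_def)
      next
        case False
        then have "step d N b s = 0" unfolding step_cell[OF d k] by (auto simp: b_def)
        then show ?thesis using pos by simp
      qed
    next
      case False
      then show ?thesis using step_nonpos[OF d, of s N b] pos[of s] by simp
    qed
  qed
  also have "\<dots> = ennreal l"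
    using int pos unfolding l_def set_lebesgue_integral_def set_integrable_def
    by (subst nn_integral_eq_integral) auto
  finally have bl: "d * sum b {..<N} \<le> l" using l0 by (simp add: ennreal_le_iff)
  have "(1 - d / t) * w (t + d) \<le> d * sum b {..<N}"
  proof (cases "j \<le> N")
    case False
    then have "real N * d \<le> real j * d" using d by (intro mult_right_mono) auto
    then have "real N * d \<le> t + d" using jt by linarith
    then have "w (t + d) = 0" using N by (intro w_eq_0) (auto intro: order_trans ennreal_leI)
    then show ?thesis using b d by (auto intro!: mult_nonneg_nonneg sum_nonneg)
  next
    case True
    have j0: "0 < real j" using j(1) \<open>0 < t / d\<close> by linarith
    have wN: "w (real N * d) = 0" by (rule w_eq_0[OF N])
    \<comment> \<open>\<open>t / d \<le> j\<close> gives \<open>1 / Suc j \<le> d / t\<close>. In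
      this form the factor visibly tends to 1 as \<open>d\<close> tends to 0.\<close>
    have "1 - d / t \<le> real j / real (Suc j)"
    proof -
      have "1 \<le> d / t * real (Suc j)" using j(1) t d by (simp add: field_simps)
      then show ?thesis by (simp add: field_simps)
    qed
    then have "(1 - d / t) * w (t + d) \<le> real j / real (Suc j) * w (t + d)"
      using w_nonneg by (intro mult_right_mono)
    also have "\<dots> \<le> real j / real (Suc j) * w (real j * d)"
      using jt by (intro mult_left_mono w_antimono) auto
    also have "\<dots> = real j / real (Suc j) * (\<Sum>k=j..<N. w (real k * d) - w (real (Suc k) * d))"
      using sum_Suc_diff'[OF True, of "\<lambda>k. - w (real k * d)"] wN by simp
    also have "\<dots> \<le> (\<Sum>k=j..<N. d * b k)"
      unfolding sum_distrib_left
    proof (rule sum_mono)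
      fix k assume k: "k \<in> {j..<N}"
      have "real k * d \<le> real (Suc k) * d" using d by (intro mult_right_mono) auto
      then have dw: "0 \<le> w (real k * d) - w (real (Suc k) * d)" using w_antimono by simp
      have "real j / real (Suc j) \<le> real k / real (Suc k)" using k by (simp add: field_simps)
      also have "\<dots> \<le> I (real k * d) / I (real (Suc k) * d)"
        using I_ratio[OF d, of k] Ipos[of k] by (simp only: pos_le_divide_eq)
      finally have "real j / real (Suc j) * (w (real k * d) - w (real (Suc k) * d))
          \<le> I (real k * d) / I (real (Suc k) * d) * (w (real k * d) - w (real (Suc k) * d))"
        using dw by (rule mult_right_mono)
      also have "\<dots> = d * b k" using k d by (simp add: b_def slope_def)
      finally show "real j / real (Suc j) * (w (real k * d) - w (real (Suc k) * d)) \<le> d * b k" .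
    qed
    also have "\<dots> \<le> (\<Sum>k<N. d * b k)" using b d by (intro sum_mono2) auto
    finally show ?thesis by (simp add: sum_distrib_left)
  qed
  with bl have "(1 - d / t) * w (t + d) \<le> l" by simp
  then show ?thesis unfolding iso_hardy_def l_def[symmetric]
    using t I_pos[OF t] by (intro mult_left_mono) auto
qed

lemma measurable_I [measurable]: "I \<in> borel_measurable lebesgue_pos"
proof -
  have "continuous_on {0<..} I"
    using iso unfolding isoperimetric_space_def by (auto intro: continuous_on_subset)
  then have "I \<in> borel_measurable (restrict_space borel {0<..})" by (rule borel_measurable_continuous_on_restrict)
  moreover have "sets (restrict_space borel {0<..}) = sets lebesgue_pos"
    by (intro sets_restrict_space_cong) simp
  ultimately show ?thesis using measurable_cong_sets by blast
qed

lemma iso_hardy_rearr_norm_le: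
  assumes res: "resonant M" and rep: "represents M \<sigma> \<rho>" and bdd: "iso_hardy_bounded I \<sigma>"
  shows "\<sigma> (\<lambda>t. ennreal (I t / t * w t)) \<le> op_norm \<sigma> (iso_hardy I) * \<rho> (grad_mod f)"
proof -
  have bfn: "banach_function_norm lebesgue_pos \<sigma>" using rep by (simp add: represents_def ri_norm_def)
  obtain V where V: "emeasure M {x. f x \<noteq> 0} \<le> ennreal V" using ex_support_measure by auto
  \<comment> \<open>The lower bound of \<open>iso_hardy_step_ge\<close> at mesh
    \<open>1 / Suc n\<close>. The maximum with 0 keeps the factor nonnegative when \<open>t\<close>
    is below the mesh, so that the product increases with \<open>n\<close>.\<close>
  define z where "z = (\<lambda>n t. ennreal (I t / t * (max 0 (1 - 1 / real (Suc n) / t) * w (t + 1 / real (Suc n)))))"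
  have idm: "(\<lambda>t. t) \<in> borel_measurable lebesgue_pos" by (rule measurable_lebesgue_posI) simp
  have wm: "(\<lambda>t. w (t + c)) \<in> borel_measurable lebesgue_pos" for c
    by (rule measurable_lebesgue_posI) measurable
  show ?thesis
  proof (rule bfn_le_of_increasing[OF bfn, where F = z])
    show "z n \<in> borel_measurable lebesgue_pos" for n
      unfolding z_def using measurable_I idm wm[of "1 / real (Suc n)"] by measurable
    show "(\<lambda>t. ennreal (I t / t * w t)) \<in> borel_measurable lebesgue_pos"
      using measurable_I idm wm[of 0] by simp
    have "antimono_on {0<..} w" by (intro monotone_onI w_antimono)
    from antimono_AE_right_limit[OF this]
    show "AE t in lebesgue_pos. incseq (\<lambda>n. z n t) \<and> (\<lambda>n. z n t) \<longlonglongrightarrow> ennreal (I t / t * w t)"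
      unfolding AE_lebesgue_pos
    proof (rule AE_mp, intro AE_I2 impI conjI)
      fix t :: real assume lim: "0 < t \<longrightarrow> (\<lambda>n. w (t + 1 / real (Suc n))) \<longlonglongrightarrow> w t" and t: "0 < t"
      show "incseq (\<lambda>n. z n t)"
      proof (rule incseq_SucI)
        fix n
        have "1 / real (Suc (Suc n)) \<le> 1 / real (Suc n)" by (intro divide_left_mono) auto
        then have "1 / real (Suc (Suc n)) / t \<le> 1 / real (Suc n) / t"
          using t by (intro divide_right_mono) auto
        moreover have "w (t + 1 / real (Suc n)) \<le> w (t + 1 / real (Suc (Suc n)))"
          by (intro w_antimono add_left_mono) fact
        ultimately show "z n t \<le> z (Suc n) t" unfolding z_def
          using t I_pos[OF t] w_nonneg by (intro ennreal_leI mult_left_mono mult_mono) auto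
      qed
      have "(\<lambda>n. 1 / real (Suc n)) \<longlonglongrightarrow> 0" using LIMSEQ_inverse_real_of_nat by (simp add: inverse_eq_divide)
      then have "(\<lambda>n. I t / t * (max 0 (1 - 1 / real (Suc n) / t) * w (t + 1 / real (Suc n)))) \<longlonglongrightarrow>
          I t / t * (max 0 (1 - 0 / t) * w t)"
        using lim t by (intro tendsto_intros) auto
      then show "(\<lambda>n. z n t) \<longlonglongrightarrow> ennreal (I t / t * w t)"
        unfolding z_def by (intro tendsto_ennrealI) simp
    qed
    show "\<forall>\<^sub>F n in sequentially. \<sigma> (z n) \<le> op_norm \<sigma> (iso_hardy I) * \<rho> (grad_mod f)"
    proof (intro always_eventually allI)
      fix n
      define d where "d = 1 / real (Suc n)"
      have d: "0 < d" by (simp add: d_def)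
      \<comment> \<open>Enough cells to reach past the measure of the support, so that
        \<open>w\<close> vanishes at the last node.\<close>
      obtain N :: nat where "V / d \<le> real N" using real_arch_simple by blast
      then have "V \<le> real N * d" using d by (simp add: field_simps)
      then have N: "emeasure M {x. f x \<noteq> 0} \<le> ennreal (real N * d)" using V by (auto intro: order_trans ennreal_leI)
      define h where "h = step d N (slope d)"
      have h0: "0 \<le> h s" for s unfolding h_def using slope_nonneg[OF d] by (intro step_nonneg) auto
      then have ah: "absf h = (\<lambda>x. ennreal (step d N (slope d) x))" by (auto simp: absf_def h_def)
      have hf: "h \<in> fspace lebesgue_pos \<sigma>"
      proof -
        have "\<sigma> (absf h) < \<infinity>" unfolding ah using slope_nonneg[OF d] by (intro step_norm_finite[OF bfn d]) auto
        moreover have "h \<in> borel_measurable lebesgue_pos"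
          unfolding h_def by (rule measurable_lebesgue_posI) measurable
        ultimately show ?thesis by (simp add: fspace_def)
      qed
      have Tm: "iso_hardy I h \<in> borel_measurable lebesgue_pos"
        using bdd hf unfolding iso_hardy_bounded_def fspace_def by auto
      have "\<sigma> (z n) \<le> \<sigma> (absf (iso_hardy I h))"
      proof (rule bfn_mono_pos[OF bfn])
        fix t :: real assume t: "0 < t"
        \<comment> \<open>Boundedness of the operator includes this convergence; without it the
          Bochner integral would be 0 by default and the lower bound could fail.\<close>
        have "set_integrable lborel {t<..} (\<lambda>s. h s / I s)"
          using bdd hf t unfolding iso_hardy_bounded_def by auto
        then have ge: "I t / t * ((1 - d / t) * w (t + d)) \<le> iso_hardy I h t"
          unfolding h_def by (rule iso_hardy_step_ge[OF d t N])
        have "I t / t * (max 0 (1 - d / t) * w (t + d)) \<le> \<bar>iso_hardy I h t\<bar>"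
        proof (cases "0 \<le> 1 - d / t")
          case True
          then show ?thesis using ge by (simp add: max_def)
        next
          case False
          then show ?thesis by (simp add: max_def)
        qed
        then show "z n t \<le> absf (iso_hardy I h) t"
          unfolding z_def d_def[symmetric] absf_def by (rule ennreal_leI)
      next
        show "absf (iso_hardy I h) \<in> borel_measurable lebesgue_pos" using Tm by measurable
        show "z n \<in> borel_measurable lebesgue_pos"
          unfolding z_def using measurable_I idm wm[of "1 / real (Suc n)"] by measurable
      qed
      also have "\<dots> \<le> op_norm \<sigma> (iso_hardy I) * \<sigma> (absf h)" by (rule op_norm_bound[OF bfn bdd hf])
      also have "\<dots> \<le> op_norm \<sigma> (iso_hardy I) * \<rho> (grad_mod f)"
        unfolding ah by (intro mult_left_mono polya_szego_norm[OF res rep d]) simp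
      finally show "\<sigma> (z n) \<le> op_norm \<sigma> (iso_hardy I) * \<rho> (grad_mod f)" .
    qed
  qed
qed

section \<open>Products with Marcinkiewicz functions\<close>

text \<open>Boundedness of \<open>g\<close> makes its rearrangement finite and gives the bounded
  majorant that \<open>hardy_littlewood_polya\<close> asks for. The estimate is uniform in
  \<open>B\<close>, so it survives removing a truncation.\<close>

lemma bounded_product_norm_le:
  assumes res: "resonant M" and rep: "represents M \<sigma> \<rho>" and bdd: "iso_hardy_bounded I \<sigma>"
    and [measurable]: "g \<in> borel_measurable borel" and gB: "\<And>x. \<bar>g x\<bar> \<le> B"
    and C: "0 \<le> C" "\<And>t. 0 < t \<Longrightarrow> rearr M (absf g) t * ennreal (t / I t) \<le> ennreal C"
  shows "\<rho> (absf (\<lambda>x. f x * g x)) \<le> ennreal C * op_norm \<sigma> (iso_hardy I) * \<rho> (grad_mod f)"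
proof -
  have ri: "ri_norm lebesgue_pos \<sigma>" using rep by (simp add: represents_def)
  then have bfn: "banach_function_norm lebesgue_pos \<sigma>" by (simp add: ri_norm_def)
  obtain A where A: "0 \<le> A" "\<forall>x. \<bar>f x\<bar> \<le> A" using Lip0_bounded[OF f] by auto
  have B: "0 \<le> B" using gB[of undefined] by simp
  define p where "p = (\<lambda>s. enn2real (rearr M (absf (\<lambda>x. f x * g x)) s))"
  define v where "v = (\<lambda>s. enn2real (rearr M (absf g) s))"
  have "rearr M (absf (\<lambda>x. f x * g x)) s \<le> ennreal (A * B)" for s
    using A gB by (intro rearr_le_bound) (auto simp: absf_def abs_mult intro!: ennreal_leI mult_mono)
  then have p: "rearr M (absf (\<lambda>x. f x * g x)) s = ennreal (p s)" for s
    unfolding p_def by (intro ennreal_enn2real_of_le[symmetric])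
  have rB: "rearr M (absf g) s \<le> ennreal B" for s
    using gB by (intro rearr_le_bound) (auto simp: absf_def intro!: ennreal_leI)
  then have v: "rearr M (absf g) s = ennreal (v s)" for s
    unfolding v_def by (intro ennreal_enn2real_of_le[symmetric])
  have wA: "w s \<le> A" for s
  proof -
    have "rearr M (absf f) s \<le> ennreal A"
      using A by (intro rearr_le_bound) (auto simp: absf_def intro!: ennreal_leI)
    then show ?thesis using A by (simp add: rearr_f)
  qed
  have p0: "0 \<le> p s" and v0: "0 \<le> v s" and vB: "v s \<le> B" for s
    using rB[of s] B by (auto simp: p_def v) (auto simp: v_def)
  have [measurable]: "p \<in> borel_measurable borel" "v \<in> borel_measurable borel"
    unfolding p_def v_def by (intro borel_measurable_rearr; simp add: p v)+
  have pa: "p y \<le> p x" if "x \<le> y" for x y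
    using rearr_antimono[OF that, of M "absf (\<lambda>x. f x * g x)"] p0 by (simp add: p)
  have va: "v y \<le> v x" if "x \<le> y" for x y
    using rearr_antimono[OF that, of M "absf g"] v0 by (simp add: v)
  have "\<rho> (absf (\<lambda>x. f x * g x)) = \<sigma> (rearr M (absf (\<lambda>x. f x * g x)))"
  proof -
    have "absf (\<lambda>x. f x * g x) \<in> borel_measurable M" by measurable
    moreover have "AE x in M. absf (\<lambda>x. f x * g x) x < \<infinity>" by (simp add: absf_def)
    ultimately show ?thesis using rep unfolding represents_def by blast
  qed
  also have "\<dots> = \<sigma> (\<lambda>s. ennreal (p s))" 
  proof -
    have "rearr M (absf (\<lambda>x. f x * g x)) = (\<lambda>s. ennreal (p s))" using p by auto
    then show ?thesis by simp
  qed
  also have "\<dots> \<le> \<sigma> (\<lambda>s. ennreal (w s * v s))"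
  proof (rule hardy_littlewood_polya[OF ri])
    show "antimono_on {0<..} p" by (intro monotone_onI pa)
    show "antimono_on {0<..} (\<lambda>s. w s * v s)"
      using w_antimono va w_nonneg v0 by (intro monotone_onI mult_mono) auto
    show "0 \<le> w x * v x" for x using w_nonneg v0 by simp
    show "w x * v x \<le> A * B" for x using wA vB v0 A by (intro mult_mono) auto
    fix t :: real assume t: "0 < t"
    \<comment> \<open>An infimum over the empty set would be infinite, so a set of measure exactly
      \<open>t\<close> exists; \<open>resonant_rearr_mult\<close> tests with its indicator.\<close>
    have "iso_inf M t < \<infinity>" using iso t by (simp add: isoperimetric_space_def)
    then have "{A \<in> sets M. emeasure M A = ennreal t} \<noteq> {}" 
      unfolding iso_inf_def by (metis image_empty Inf_empty infinity_ennreal_def less_irrefl)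
    then obtain F where F: "F \<in> sets M" "emeasure M F = ennreal t" by auto
    have "(\<integral>\<^sup>+s\<in>{0<..t}. rearr M (absf (\<lambda>x. f x * g x)) s \<partial>lborel)
        \<le> (\<integral>\<^sup>+s\<in>{0<..t}. rearr M (absf f) s * rearr M (absf g) s \<partial>lborel)"
      by (rule resonant_rearr_mult[OF res _ _ F t]) measurable
    then show "(\<integral>\<^sup>+x\<in>{0<..t}. ennreal (p x) \<partial>lborel) \<le> (\<integral>\<^sup>+x\<in>{0<..t}. ennreal (w x * v x) \<partial>lborel)"
      using w_nonneg v0 by (simp add: p rearr_f v ennreal_mult)
  qed (auto simp: p0)
  also have "\<dots> \<le> \<sigma> (\<lambda>t. ennreal C * ennreal (I t / t * w t))"
  proof (rule bfn_mono_pos[OF bfn])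
    fix t :: real assume t: "0 < t"
    have "ennreal (v t * (t / I t)) \<le> ennreal C"
      using C(2)[OF t] v0[of t] t I_pos[OF t] by (subst ennreal_mult) (auto simp: v)
    then have "v t * (t / I t) \<le> C" using C(1) by (simp add: ennreal_le_iff)
    \<comment> \<open>The Marcinkiewicz bound in this form turns the product of rearrangements into
      the function estimated by \<open>iso_hardy_rearr_norm_le\<close>.\<close>
    then have "v t \<le> C * (I t / t)" using t I_pos[OF t] by (simp add: field_simps)
    then have "w t * v t \<le> w t * (C * (I t / t))" using w_nonneg by (intro mult_left_mono)
    then have "ennreal (w t * v t) \<le> ennreal (C * (I t / t * w t))" by (intro ennreal_leI) (simp add: mult_ac)
    then show "ennreal (w t * v t) \<le> ennreal C * ennreal (I t / t * w t)"
      using C(1) t I_pos[OF t] w_nonneg[of t] by (subst ennreal_mult[symmetric]) auto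
  next
    have "(\<lambda>t. t) \<in> borel_measurable lebesgue_pos" "w \<in> borel_measurable lebesgue_pos"
      by (rule measurable_lebesgue_posI, simp)+
    then show "(\<lambda>t. ennreal C * ennreal (I t / t * w t)) \<in> borel_measurable lebesgue_pos" by measurable
    show "(\<lambda>t. ennreal (w t * v t)) \<in> borel_measurable lebesgue_pos"
      by (rule measurable_lebesgue_posI) measurable
  qed
  also have "\<dots> = ennreal C * \<sigma> (\<lambda>t. ennreal (I t / t * w t))"
  proof (rule bfn_scale[OF bfn _ C(1)])
    have "(\<lambda>t. t) \<in> borel_measurable lebesgue_pos" "w \<in> borel_measurable lebesgue_pos"
      by (rule measurable_lebesgue_posI, simp)+
    then show "(\<lambda>t. ennreal (I t / t * w t)) \<in> borel_measurable lebesgue_pos" by measurable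
  qed
  also have "\<dots> \<le> ennreal C * (op_norm \<sigma> (iso_hardy I) * \<rho> (grad_mod f))"
    by (intro mult_left_mono iso_hardy_rearr_norm_le[OF res rep bdd]) simp
  finally show ?thesis by (simp add: mult.assoc)
qed

end

theorem mainTheorem9:
  fixes M :: "'a::metric_space measure"
    and \<rho> :: "('a \<Rightarrow> ennreal) \<Rightarrow> ennreal"
    and \<sigma> :: "(real \<Rightarrow> ennreal) \<Rightarrow> ennreal"
    and f g :: "'a \<Rightarrow> real"
    and \<Phi> :: "real \<Rightarrow> real"
  defines "\<Phi> \<equiv> \<lambda>t. t / iso_profile M t"
  assumes "isoperimetric_space M"
    and "resonant M"
    and "ri_norm M \<rho>"
    and "represents M \<sigma> \<rho>"
    and "iso_hardy_bounded (iso_profile M) \<sigma>"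
    and "f \<in> Lip0"
    and "g \<in> marc_space M \<Phi>"
  shows "\<rho> (absf (\<lambda>x. f x * g x))
    \<le> marc_norm M \<Phi> g * op_norm \<sigma> (iso_hardy (iso_profile M)) * \<rho> (grad_mod f)"
proof -
  interpret isoperimetric_lip M f using assms by unfold_locales
  have bfn: "banach_function_norm M \<rho>" using assms(4) by (simp add: ri_norm_def)
  have "g \<in> borel_measurable M" and fin: "marc_norm M \<Phi> g < \<infinity>" using assms(8) by (auto simp: marc_space_def)
  then have [measurable]: "g \<in> borel_measurable borel" using measurable_cong_sets[OF sets_M refl] by blast
  define C where "C = enn2real (marc_norm M \<Phi> g)"
  have C: "marc_norm M \<Phi> g = ennreal C" "0 \<le> C" using fin by (auto simp: C_def less_top)
  \<comment> \<open>Truncation does not raise the rearrangement, so one constant \<open>C\<close>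
    serves all \<open>gk k\<close>, while the products with \<open>f\<close> increase in absolute
    value to that of \<open>f * g\<close>.\<close>
  define gk where "gk = (\<lambda>k::nat. \<lambda>x. max (- real k) (min (real k) (g x)))"
  have abs_gk: "\<bar>gk k x\<bar> = min (real k) \<bar>g x\<bar>" for k x by (auto simp: gk_def)
  have [measurable]: "gk k \<in> borel_measurable borel" for k unfolding gk_def by measurable
  show ?thesis
  proof (rule bfn_le_of_increasing[OF bfn, where F = "\<lambda>k. absf (\<lambda>x. f x * gk k x)"])
    show "absf (\<lambda>x. f x * gk k x) \<in> borel_measurable M" for k by measurable
    show "absf (\<lambda>x. f x * g x) \<in> borel_measurable M" by measurable
    show "AE x in M. incseq (\<lambda>k. absf (\<lambda>x. f x * gk k x) x) \<and> (\<lambda>k. absf (\<lambda>x. f x * gk k x) x) \<longlonglongrightarrow> absf (\<lambda>x. f x * g x) x"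
    proof (intro AE_I2 conjI)
      fix x
      show "incseq (\<lambda>k. absf (\<lambda>x. f x * gk k x) x)"
        by (intro incseq_SucI) (auto simp: absf_def abs_mult abs_gk intro!: ennreal_leI mult_left_mono)
      have "eventually (\<lambda>k. absf (\<lambda>x. f x * g x) x = absf (\<lambda>x. f x * gk k x) x) sequentially"
        using eventually_ge_at_top[of "nat \<lceil>\<bar>g x\<bar>\<rceil>"]
      proof eventually_elim
        case (elim k)
        then have "\<bar>g x\<bar> \<le> real k" by linarith
        then show ?case by (simp add: absf_def abs_mult abs_gk)
      qed
      then show "(\<lambda>k. absf (\<lambda>x. f x * gk k x) x) \<longlonglongrightarrow> absf (\<lambda>x. f x * g x) x"
        by (intro tendsto_eventually) (auto elim: eventually_mono)
    qed
    show "\<forall>\<^sub>F k in sequentially. \<rho> (absf (\<lambda>x. f x * gk k x))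
        \<le> marc_norm M \<Phi> g * op_norm \<sigma> (iso_hardy I) * \<rho> (grad_mod f)"
    proof (intro always_eventually allI)
      fix k
      have "rearr M (absf (gk k)) t * ennreal (t / I t) \<le> ennreal C" if t: "0 < t" for t
      proof -
        have "rearr M (absf (gk k)) t * ennreal (t / I t) \<le> rearr M (absf g) t * ennreal (t / I t)"
          by (intro mult_right_mono rearr_mono_AE) (auto simp: absf_def abs_gk intro: ennreal_leI)
        also have "\<dots> \<le> marc_norm M \<Phi> g"
          unfolding marc_norm_def \<Phi>_def using t by (intro SUP_upper) auto
        finally show ?thesis by (simp add: C)
      qed
      then show "\<rho> (absf (\<lambda>x. f x * gk k x))
          \<le> marc_norm M \<Phi> g * op_norm \<sigma> (iso_hardy I) * \<rho> (grad_mod f)"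
        unfolding C(1) using C(2) assms(3,5,6)
        by (intro bounded_product_norm_le[where B = "real k"]) (auto simp: abs_gk)
    qed
  qed
qed

end
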